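(* Let $G$ be a propositional formula with $G\notin\mathrm{IPL}$. Then there exists an $\mathbf{FRJ}(G)$-derivation $\tilde{\mathcal D}$ of $G$ such that the height of the extracted model $\mathrm{Mod}(\tilde{\mathcal D})$ equals $h(G)$, the minimum height of a Kripke countermodel for $G$.
   Context: Formulas are built from a countably infinite set $\mathcal{V}$ of propositional variables and $\bot$ using $\land,\lor,\supset$. Let $\mathcal{V}_\bot=\mathcal{V}\cup\{\bot\}$, $\mathcal{L}^{\supset}$ the set of formulas with main connective $\supset$. For a formula $G$, $\mathrm{Sl}(G)$ and $\mathrm{Sr}(G)$ are the smallest subsets of the subformulas of $G$ with: $G\in\mathrm{Sr}(G)$; $A\land B$ or $A\lor B$ in $\mathrm{Sl}(G)$ (resp. $\mathrm{Sr}(G)$) implies $A,B$ in $\mathrm{Sl}(G)$ (resp. $\mathrm{Sr}(G)$); $A\supset B\in\mathrm{Sl}(G)$ implies $B\in\mathrm{Sl}(G)$, $A\in\mathrm{Sr}(G)$; $A\supset B\in\mathrm{Sr}(G)$ implies $B\in\mathrm{Sr}(G)$, $A\in\mathrm{Sl}(G)$. $\mathrm{Cl}(\Gamma)$ is the smallest set containing $\Gamma$ such that if $X,Y\in\mathrm{Cl}(\Gamma)$ and $A$ is any formula then $X\land Y,A\lor X,X\lor A,A\supset X\in\mathrm{Cl}(\Gamma)$. $\mathbf{FRJ}(G)$: let $\bar\Gamma^{At}=\mathrm{Sl}(G)\cap\mathcal V$, $\bar\Gamma^{\supset}=\mathrm{Sl}(G)\cap\mathcal L^{\supset}$, $\bar\Gamma=\bar\Gamma^{At}\cup\bar\Gamma^{\supset}$.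 Sequents: regular $\Gamma\Rightarrow C$ ($\Gamma\subseteq\bar\Gamma$, $C\in\mathrm{Sr}(G)$), irregular $\Sigma;\Theta\rightarrow C$ ($\Sigma\cup\Theta\subseteq\bar\Gamma$, $C\in\mathrm{Sr}(G)$); $\mathrm{Lhs}$ is $\Gamma$, resp. $\Sigma\cup\Theta$; conclusions always have right formula in $\mathrm{Sr}(G)$. Rules ($F\in\mathcal V_\bot$, $k\in\{1,2\}$): axioms $\bar\Gamma^{At}\setminus\{F\}\Rightarrow F$ and $\emptyset;(\bar\Gamma^{At}\setminus\{F\})\cup\bar\Gamma^{\supset}\rightarrow F$; ($\land$) $\Gamma\Rightarrow A_k/\Gamma\Rightarrow A_1\land A_2$ and $\Sigma;\Theta\rightarrow A_k/\Sigma;\Theta\rightarrow A_1\land A_2$; ($\lor$) $\Sigma_1;\Theta_1\rightarrow C_1$, $\Sigma_2;\Theta_2\rightarrow C_2 / \Sigma_1\cup\Sigma_2;\Theta_1\cap\Theta_2\rightarrow C_1\lor C_2$ if $\Sigma_1\subseteq\Sigma_2\cup\Theta_2$, $\Sigma_2\subseteq\Sigma_1\cup\Theta_1$; ($\supset_\in$) $\Gamma\Rightarrow B/\Gamma\Rightarrow A\supset B$ if $A\in\mathrm{Cl}(\Gamma)$, and $\Sigma;\Theta\cup\Lambda\rightarrow B/\Sigma\cup\Lambda;\Theta\rightarrow A\supset B$ if $\Theta\cap\Lambda=\emptyset$, $A\in\mathrm{Cl}(\Sigma\cup\Lambda)$ and no $\Lambda'\subsetneq\Lambda$ has $A\in\mathrm{Cl}(\Sigma\cup\Lambda')$;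 ($\supset_{\notin}$) $\Gamma\Rightarrow B/\emptyset;\Theta\rightarrow A\supset B$ if $\Theta\subseteq\mathrm{Cl}(\Gamma)\cap\bar\Gamma$, $A\in\mathrm{Cl}(\Gamma)\setminus\mathrm{Cl}(\Theta)$ and every $\Theta'$ with $\Theta\subsetneq\Theta'\subseteq\mathrm{Cl}(\Gamma)\cap\bar\Gamma$ has $A\in\mathrm{Cl}(\Theta')$; join rules with premises $\Sigma_j;\Theta_j\rightarrow A_j$ ($1\le j\le n$, $n\ge1$): let $\Upsilon=\{A_1,\dots,A_n\}$, $\Sigma^{At}=\bigcup_j(\Sigma_j\cap\mathcal V)$, $\Sigma^{\supset}=\bigcup_j(\Sigma_j\cap\mathcal L^{\supset})$, $\Theta^{At}=\bigcap_j(\Theta_j\cap\mathcal V)$, $\Theta^{\supset}=\{Y\supset Z\in\bigcap_j(\Theta_j\cap\mathcal L^{\supset}):Y\in\Upsilon\}$, requiring $\Sigma_i\subseteq\Sigma_j\cup\Theta_j$ ($i\ne j$) and ($Y\supset Z\in\Sigma^{\supset}\Rightarrow Y\in\Upsilon$); ($\bowtie^{At}$) conclusion $\Sigma^{At}\cup(\Theta^{At}\setminus\{F\})\cup\Sigma^{\supset}\cup\Theta^{\supset}\Rightarrow F$, $F\in\mathcal V_\bot\setminus\Sigma^{At}$, where each $Y\in\Upsilon$ has some $Y\supset Z\in\mathrm{Sl}(G)$; ($\bowtie^{\lor}$) conclusion $\Sigma^{At}\cup\Theta^{At}\cup\Sigma^{\supset}\cup\Theta^{\supset}\Rightarrow C_1\lor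 C_2$, $\{C_1,C_2\}\subseteq\Upsilon$, where each $Y\in\Upsilon$ has some $Y\supset Z\in\mathrm{Sl}(G)$ or $Y\lor Z\in\mathrm{Sr}(G)$ or $Z\lor Y\in\mathrm{Sr}(G)$. An $\mathbf{FRJ}(G)$-derivation of $G$ is a derivation (finite tree with axioms at leaves) of some regular sequent $\Gamma\Rightarrow G$. Write $\sigma_1\mapsto_0\sigma_2$ if some rule instance has conclusion $\sigma_2$ and $\sigma_1$ among its premises; $\mapsto_*$ is the reflexive-transitive closure. For a derivation $\mathcal D$ of $G$, a p-sequent is a regular sequent occurring in $\mathcal D$ that is an axiom or the conclusion of a join rule; $\mathrm{Mod}(\mathcal D)=(P,\le,\rho,V)$ where $P$ is the set of p-sequents of $\mathcal D$, $\sigma_1\le\sigma_2$ iff $\sigma_2\mapsto_*\sigma_1$, $\rho$ is the $\le$-minimum, and $V(\sigma)=\mathrm{Lhs}(\sigma)\cap\mathcal V$; this is a Kripke model. Kripke models are finite posets with root and monotone valuations, with standard intuitionistic forcing; a countermodel for $G$ is one whose root does not force $G$. The height of a world is $0$ if it is maximal and otherwise $1+$ the maximal height of a strictly greater world; the height of a model is the height of its root. $h(G)$ is the minimum height of a countermodel for $G$.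
   Formalization: The relation ↦₀ ordering Mod(D) uses only rule instances occurring in D, not arbitrary rule instances; with all instances the claim fails for G = ((q⊃r)∨(p⊃(q∨s)))∨(u⊃(p∨v)), where h(G)=1 but every Mod(D) has height at least 2. *)

theory Defs
  imports Main
begin

subsection \<open>Formulas and intuitionistic propositional logic\<close>

datatype form =
    Var nat
  | Bot
  | And form form
  | Or form form
  | Imp form form

definition Vars :: "form set" where
  "Vars = range Var"

definition VarsBot :: "form set" where
  "VarsBot = insert Bot Vars"

definition Imps :: "form set" where
  "Imps = {Imp A B | A B. True}"

text \<open>IPL is given by its standard natural deduction system, with sets as contexts.\<close>

inductive nd :: "form set \<Rightarrow> form \<Rightarrow> bool" where
  nd_ass:   "A \<in> X \<Longrightarrow> nd X A"
| nd_botE:  "nd X Bot \<Longrightarrow> nd X A"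
| nd_andI:  "nd X A \<Longrightarrow> nd X B \<Longrightarrow> nd X (And A B)"
| nd_andE1: "nd X (And A B) \<Longrightarrow> nd X A"
| nd_andE2: "nd X (And A B) \<Longrightarrow> nd X B"
| nd_orI1:  "nd X A \<Longrightarrow> nd X (Or A B)"
| nd_orI2:  "nd X B \<Longrightarrow> nd X (Or A B)"
| nd_orE:   "nd X (Or A B) \<Longrightarrow> nd (insert A X) C \<Longrightarrow> nd (insert B X) C \<Longrightarrow> nd X C"
| nd_impI:  "nd (insert A X) B \<Longrightarrow> nd X (Imp A B)"
| nd_impE:  "nd X (Imp A B) \<Longrightarrow> nd X A \<Longrightarrow> nd X B"

definition IPL :: "form set" where
  "IPL = {A. nd {} A}"

subsection \<open>Kripke models\<close>

record 'w kripke =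
  worlds :: "'w set"
  le :: "'w \<Rightarrow> 'w \<Rightarrow> bool"
  root :: 'w
  val :: "'w \<Rightarrow> nat set"

definition kripke_model :: "'w kripke \<Rightarrow> bool" where
  "kripke_model K \<longleftrightarrow>
     finite (worlds K) \<and>
     reflp_on (worlds K) (le K) \<and> antisymp_on (worlds K) (le K) \<and> transp_on (worlds K) (le K) \<and>
     root K \<in> worlds K \<and> (\<forall>w\<in>worlds K. le K (root K) w) \<and>
     (\<forall>v\<in>worlds K. \<forall>w\<in>worlds K. le K v w \<longrightarrow> val K v \<subseteq> val K w)"

primrec forces :: "'w kripke \<Rightarrow> 'w \<Rightarrow> form \<Rightarrow> bool" where
  "forces K w (Var p) \<longleftrightarrow> p \<in> val K w"
| "forces K w Bot \<longleftrightarrow> False"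
| "forces K w (And A B) \<longleftrightarrow> forces K w A \<and> forces K w B"
| "forces K w (Or A B) \<longleftrightarrow> forces K w A \<or> forces K w B"
| "forces K w (Imp A B) \<longleftrightarrow> (\<forall>v\<in>worlds K. le K w v \<longrightarrow> forces K v A \<longrightarrow> forces K v B)"

definition countermodel :: "'w kripke \<Rightarrow> form \<Rightarrow> bool" where
  "countermodel K G \<longleftrightarrow> kripke_model K \<and> \<not> forces K (root K) G"

definition above :: "'w kripke \<Rightarrow> 'w \<Rightarrow> 'w set" where
  "above K w = {v \<in> worlds K. le K w v \<and> v \<noteq> w}"

lemma above_psubset:
  assumes "kripke_model K" "w \<in> worlds K" "v \<in> above K w"
  shows "above K v \<subset> above K w"
proof -
  have v: "v \<in> worlds K" "le K w v" "v \<noteq> w"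
    using assms(3) by (auto simp: above_def)
  have "above K v \<subseteq> above K w"
  proof
    fix u assume "u \<in> above K v"
    then have u: "u \<in> worlds K" "le K v u" "u \<noteq> v" by (auto simp: above_def)
    have "le K w u"
      using assms(1,2) v u unfolding kripke_model_def by (blast dest: transp_onD)
    moreover have "u \<noteq> w"
      using assms(1,2) v u unfolding kripke_model_def by (blast dest: antisymp_onD)
    ultimately show "u \<in> above K w" using u by (simp add: above_def)
  qed
  moreover have "v \<notin> above K v" by (simp add: above_def)
  ultimately show ?thesis using assms(3) by blast
qed

text \<open>The guard only makes the recursion total; on Kripke models the defining recursion of the
  height is \<open>height_rec\<close> below.\<close>

function height :: "'w kripke \<Rightarrow> 'w \<Rightarrow> nat" where
  "height K w =
     (if kripke_model K \<and> w \<in> worlds K \<and> above K w \<noteq> {}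
      then 1 + Max (height K ` above K w) else 0)"
  by pat_completeness auto
termination
proof (relation "measure (\<lambda>(K, w). card (above K w))")
  fix K :: "'w kripke" and w v
  assume a: "kripke_model K \<and> w \<in> worlds K \<and> above K w \<noteq> {}" "v \<in> above K w"
  have "finite (above K w)"
    using a by (simp add: above_def kripke_model_def)
  then show "((K, v), (K, w)) \<in> measure (\<lambda>(K, w). card (above K w))"
    using above_psubset[of K w v] a by (auto intro: psubset_card_mono)
qed auto

declare height.simps [simp del]

lemma height_rec:
  assumes "kripke_model K" "w \<in> worlds K"
  shows "height K w = (if above K w = {} then 0 else 1 + Max (height K ` above K w))"
  using assms by (simp add: height.simps[of K w])

definition model_height :: "'w kripke \<Rightarrow> nat" where
  "model_height K = height K (root K)"

text \<open>Worlds may be taken to be natural numbers, as every finite model is isomorphic to such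
  a model; see \<open>countermodel_nat\<close>.\<close>

definition min_height :: "form \<Rightarrow> nat" where
  "min_height G = (LEAST n. \<exists>K :: nat kripke. countermodel K G \<and> model_height K = n)"

lemma countermodel_nat:
  fixes K :: "'w kripke"
  assumes "countermodel K G"
  shows "\<exists>K' :: nat kripke. countermodel K' G \<and> model_height K' = model_height K"
proof -
  let ?W = "worlds K"
  have K: "kripke_model K" and nf: "\<not> forces K (root K) G"
    using assms by (auto simp: countermodel_def)
  have fin: "finite ?W" and rt: "root K \<in> ?W" using K by (auto simp: kripke_model_def)
  obtain f :: "'w \<Rightarrow> nat" where inj: "inj_on f ?W"
    using fin finite_imp_inj_to_nat_seg by blast
  define g where "g = inv_into ?W f"
  have gf: "g (f w) = w" if "w \<in> ?W" for w
    using inj that by (simp add: g_def)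
  define K' where "K' = \<lparr>worlds = f ` ?W, le = (\<lambda>x y. le K (g x) (g y)),
                         root = f (root K), val = (\<lambda>x. val K (g x))\<rparr>"
  have K': "kripke_model K'"
    unfolding kripke_model_def
  proof (intro conjI)
    show "finite (worlds K')" using fin by (simp add: K'_def)
    show "reflp_on (worlds K') (le K')"
      using K gf by (auto simp: kripke_model_def K'_def reflp_on_def)
    show "antisymp_on (worlds K') (le K')"
      using K gf by (auto simp: kripke_model_def K'_def antisymp_on_def)
    show "transp_on (worlds K') (le K')"
    proof (rule transp_onI)
      fix x y z
      assume "x \<in> worlds K'" "y \<in> worlds K'" "z \<in> worlds K'" "le K' x y" "le K' y z"
      then have "g x \<in> ?W" "g y \<in> ?W" "g z \<in> ?W" "le K (g x) (g y)" "le K (g y) (g z)"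
        using gf by (auto simp: K'_def)
      then have "le K (g x) (g z)"
        using K unfolding kripke_model_def by (meson transp_onD)
      then show "le K' x z" by (simp add: K'_def)
    qed
    show "root K' \<in> worlds K'" using rt by (simp add: K'_def)
    show "\<forall>w\<in>worlds K'. le K' (root K') w"
      using K gf rt by (auto simp: kripke_model_def K'_def)
    show "\<forall>v\<in>worlds K'. \<forall>w\<in>worlds K'. le K' v w \<longrightarrow> val K' v \<subseteq> val K' w"
      using K gf by (simp add: kripke_model_def K'_def)
  qed
  have forc: "forces K' (f w) A = forces K w A" if "w \<in> ?W" for w A
    using that by (induction A arbitrary: w) (simp_all add: K'_def gf)
  have ab: "above K' (f w) = f ` above K w" if "w \<in> ?W" for w
  proof -
    have "f v = f w \<longleftrightarrow> v = w" if "v \<in> ?W" for v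
      using inj \<open>w \<in> ?W\<close> that by (simp add: inj_on_eq_iff)
    then show ?thesis using that by (auto simp: above_def K'_def gf)
  qed
  have ht: "height K' (f w) = height K w" if "w \<in> ?W" for w
    using that
  proof (induction "card (above K w)" arbitrary: w rule: less_induct)
    case less
    have "height K' (f v) = height K v" if "v \<in> above K w" for v
    proof (rule less.hyps)
      show "card (above K v) < card (above K w)"
        using above_psubset[OF K less.prems that] fin
        by (intro psubset_card_mono) (auto simp: above_def)
      show "v \<in> ?W" using that by (simp add: above_def)
    qed
    then have im: "height K' ` f ` above K w = height K ` above K w"
      unfolding image_image by (intro image_cong refl)
    have "f w \<in> worlds K'" using less.prems by (simp add: K'_def)
    from height_rec[OF K' this] height_rec[OF K less.prems] show ?case
      unfolding ab[OF less.prems] im by simp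
  qed
  have "countermodel K' G"
    using K' nf forc[OF rt] by (simp add: countermodel_def K'_def)
  moreover have "model_height K' = model_height K"
    using ht[OF rt] by (simp add: model_height_def K'_def)
  ultimately show ?thesis by blast
qed

subsection \<open>The calculus FRJ(G)\<close>

inductive_set Sl :: "form \<Rightarrow> form set" and Sr :: "form \<Rightarrow> form set" for G :: form where
  Sr_self: "G \<in> Sr G"
| Sl_and1: "And A B \<in> Sl G \<Longrightarrow> A \<in> Sl G"
| Sl_and2: "And A B \<in> Sl G \<Longrightarrow> B \<in> Sl G"
| Sl_or1:  "Or A B \<in> Sl G \<Longrightarrow> A \<in> Sl G"
| Sl_or2:  "Or A B \<in> Sl G \<Longrightarrow> B \<in> Sl G"
| Sr_and1: "And A B \<in> Sr G \<Longrightarrow> A \<in> Sr G"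
| Sr_and2: "And A B \<in> Sr G \<Longrightarrow> B \<in> Sr G"
| Sr_or1:  "Or A B \<in> Sr G \<Longrightarrow> A \<in> Sr G"
| Sr_or2:  "Or A B \<in> Sr G \<Longrightarrow> B \<in> Sr G"
| Sl_imp1: "Imp A B \<in> Sl G \<Longrightarrow> B \<in> Sl G"
| Sl_imp2: "Imp A B \<in> Sl G \<Longrightarrow> A \<in> Sr G"
| Sr_imp1: "Imp A B \<in> Sr G \<Longrightarrow> B \<in> Sr G"
| Sr_imp2: "Imp A B \<in> Sr G \<Longrightarrow> A \<in> Sl G"

inductive_set Cl :: "form set \<Rightarrow> form set" for X :: "form set" where
  Cl_base: "A \<in> X \<Longrightarrow> A \<in> Cl X"
| Cl_and:  "A \<in> Cl X \<Longrightarrow> B \<in> Cl X \<Longrightarrow> And A B \<in> Cl X"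
| Cl_or1:  "B \<in> Cl X \<Longrightarrow> Or A B \<in> Cl X"
| Cl_or2:  "A \<in> Cl X \<Longrightarrow> Or A B \<in> Cl X"
| Cl_imp:  "B \<in> Cl X \<Longrightarrow> Imp A B \<in> Cl X"

definition GAt :: "form \<Rightarrow> form set" where
  "GAt G = Sl G \<inter> Vars"

definition GImp :: "form \<Rightarrow> form set" where
  "GImp G = Sl G \<inter> Imps"

definition GBar :: "form \<Rightarrow> form set" where
  "GBar G = GAt G \<union> GImp G"

text \<open>\<open>Reg \<Gamma> C\<close> is the regular sequent \<open>\<Gamma> \<Rightarrow> C\<close> and \<open>Irr \<Sigma> \<Theta> C\<close> the irregular sequent
  \<open>\<Sigma>; \<Theta> \<rightarrow> C\<close>.\<close>

datatype sequent =
    Reg "form set" form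
  | Irr "form set" "form set" form

fun Lhs :: "sequent \<Rightarrow> form set" where
  "Lhs (Reg \<Gamma> C) = \<Gamma>"
| "Lhs (Irr \<Sigma> \<Theta> C) = \<Sigma> \<union> \<Theta>"

fun Rhs :: "sequent \<Rightarrow> form" where
  "Rhs (Reg \<Gamma> C) = C"
| "Rhs (Irr \<Sigma> \<Theta> C) = C"

fun regular :: "sequent \<Rightarrow> bool" where
  "regular (Reg \<Gamma> C) \<longleftrightarrow> True"
| "regular (Irr \<Sigma> \<Theta> C) \<longleftrightarrow> False"

definition is_sequent :: "form \<Rightarrow> sequent \<Rightarrow> bool" where
  "is_sequent G \<sigma> \<longleftrightarrow> Lhs \<sigma> \<subseteq> GBar G \<and> Rhs \<sigma> \<in> Sr G"

inductive ax_schema :: "form \<Rightarrow> sequent \<Rightarrow> bool" for G :: form where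
  ax_reg: "F \<in> VarsBot \<Longrightarrow> ax_schema G (Reg (GAt G - {F}) F)"
| ax_irr: "F \<in> VarsBot \<Longrightarrow> ax_schema G (Irr {} ((GAt G - {F}) \<union> GImp G) F)"

inductive logical_schema :: "form \<Rightarrow> sequent list \<Rightarrow> sequent \<Rightarrow> bool" for G :: form where
  and_reg:
    "A \<in> {A1, A2} \<Longrightarrow> logical_schema G [Reg \<Gamma> A] (Reg \<Gamma> (And A1 A2))"
| and_irr:
    "A \<in> {A1, A2} \<Longrightarrow> logical_schema G [Irr \<Sigma> \<Theta> A] (Irr \<Sigma> \<Theta> (And A1 A2))"
| or_irr:
    "\<lbrakk> \<Sigma>1 \<subseteq> \<Sigma>2 \<union> \<Theta>2; \<Sigma>2 \<subseteq> \<Sigma>1 \<union> \<Theta>1 \<rbrakk> \<Longrightarrow>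
     logical_schema G [Irr \<Sigma>1 \<Theta>1 C1, Irr \<Sigma>2 \<Theta>2 C2] (Irr (\<Sigma>1 \<union> \<Sigma>2) (\<Theta>1 \<inter> \<Theta>2) (Or C1 C2))"
| imp_in_reg:
    "A \<in> Cl \<Gamma> \<Longrightarrow> logical_schema G [Reg \<Gamma> B] (Reg \<Gamma> (Imp A B))"
| imp_in_irr:
    "\<lbrakk> \<Theta> \<inter> \<Lambda> = {}; A \<in> Cl (\<Sigma> \<union> \<Lambda>); \<forall>\<Lambda>'. \<Lambda>' \<subset> \<Lambda> \<longrightarrow> A \<notin> Cl (\<Sigma> \<union> \<Lambda>') \<rbrakk> \<Longrightarrow>
     logical_schema G [Irr \<Sigma> (\<Theta> \<union> \<Lambda>) B] (Irr (\<Sigma> \<union> \<Lambda>) \<Theta> (Imp A B))"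
| imp_notin:
    "\<lbrakk> \<Theta> \<subseteq> Cl \<Gamma> \<inter> GBar G; A \<in> Cl \<Gamma> - Cl \<Theta>;
       \<forall>\<Theta>'. \<Theta> \<subset> \<Theta>' \<and> \<Theta>' \<subseteq> Cl \<Gamma> \<inter> GBar G \<longrightarrow> A \<in> Cl \<Theta>' \<rbrakk> \<Longrightarrow>
     logical_schema G [Reg \<Gamma> B] (Irr {} \<Theta> (Imp A B))"

text \<open>The premises \<open>\<Sigma>\<^sub>j; \<Theta>\<^sub>j \<rightarrow> A\<^sub>j\<close> of a join rule are indexed by \<open>j < n\<close> with \<open>n \<ge> 1\<close>.\<close>

definition join_prems ::
    "nat \<Rightarrow> (nat \<Rightarrow> form set) \<Rightarrow> (nat \<Rightarrow> form set) \<Rightarrow> (nat \<Rightarrow> form) \<Rightarrow> sequent list" where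
  "join_prems n \<Sigma> \<Theta> A = map (\<lambda>j. Irr (\<Sigma> j) (\<Theta> j) (A j)) [0..<n]"

definition Ups :: "nat \<Rightarrow> (nat \<Rightarrow> form) \<Rightarrow> form set" where
  "Ups n A = A ` {..<n}"

definition SigAt :: "nat \<Rightarrow> (nat \<Rightarrow> form set) \<Rightarrow> form set" where
  "SigAt n \<Sigma> = (\<Union>j<n. \<Sigma> j \<inter> Vars)"

definition SigImp :: "nat \<Rightarrow> (nat \<Rightarrow> form set) \<Rightarrow> form set" where
  "SigImp n \<Sigma> = (\<Union>j<n. \<Sigma> j \<inter> Imps)"

definition ThAt :: "nat \<Rightarrow> (nat \<Rightarrow> form set) \<Rightarrow> form set" where
  "ThAt n \<Theta> = (\<Inter>j<n. \<Theta> j \<inter> Vars)"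

definition ThImp :: "nat \<Rightarrow> (nat \<Rightarrow> form set) \<Rightarrow> (nat \<Rightarrow> form) \<Rightarrow> form set" where
  "ThImp n \<Theta> A = {Imp Y Z | Y Z. Imp Y Z \<in> (\<Inter>j<n. \<Theta> j \<inter> Imps) \<and> Y \<in> Ups n A}"

definition join_cond ::
    "nat \<Rightarrow> (nat \<Rightarrow> form set) \<Rightarrow> (nat \<Rightarrow> form set) \<Rightarrow> (nat \<Rightarrow> form) \<Rightarrow> bool" where
  "join_cond n \<Sigma> \<Theta> A \<longleftrightarrow>
     n \<ge> 1 \<and>
     (\<forall>i<n. \<forall>j<n. i \<noteq> j \<longrightarrow> \<Sigma> i \<subseteq> \<Sigma> j \<union> \<Theta> j) \<and>
     (\<forall>Y Z. Imp Y Z \<in> SigImp n \<Sigma> \<longrightarrow> Y \<in> Ups n A)"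

inductive join_schema :: "form \<Rightarrow> sequent list \<Rightarrow> sequent \<Rightarrow> bool" for G :: form where
  join_at:
    "\<lbrakk> join_cond n \<Sigma> \<Theta> A; F \<in> VarsBot - SigAt n \<Sigma>;
       \<forall>Y\<in>Ups n A. \<exists>Z. Imp Y Z \<in> Sl G \<rbrakk> \<Longrightarrow>
     join_schema G (join_prems n \<Sigma> \<Theta> A)
       (Reg (SigAt n \<Sigma> \<union> (ThAt n \<Theta> - {F}) \<union> SigImp n \<Sigma> \<union> ThImp n \<Theta> A) F)"
| join_or:
    "\<lbrakk> join_cond n \<Sigma> \<Theta> A; {C1, C2} \<subseteq> Ups n A;
       \<forall>Y\<in>Ups n A. \<exists>Z. Imp Y Z \<in> Sl G \<or> Or Y Z \<in> Sr G \<or> Or Z Y \<in> Sr G \<rbrakk> \<Longrightarrow>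
     join_schema G (join_prems n \<Sigma> \<Theta> A)
       (Reg (SigAt n \<Sigma> \<union> ThAt n \<Theta> \<union> SigImp n \<Sigma> \<union> ThImp n \<Theta> A) (Or C1 C2))"

text \<open>An instance of a rule of FRJ(G): premises and conclusion have to be sequents of FRJ(G),
  in particular their right formulas belong to \<open>Sr G\<close>. Axioms are the instances without
  premises.\<close>

definition rule_inst :: "form \<Rightarrow> sequent list \<Rightarrow> sequent \<Rightarrow> bool" where
  "rule_inst G \<pi> \<sigma> \<longleftrightarrow>
     (\<pi> = [] \<and> ax_schema G \<sigma> \<or> logical_schema G \<pi> \<sigma> \<or> join_schema G \<pi> \<sigma>) \<and>
     (\<forall>\<tau>\<in>set \<pi>. is_sequent G \<tau>) \<and> is_sequent G \<sigma>"

subsection \<open>Derivations and extracted models\<close>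

datatype deriv = Der (subderivs: "deriv list") (concl: sequent)

inductive is_deriv :: "form \<Rightarrow> deriv \<Rightarrow> bool" for G :: form where
  "\<lbrakk> \<forall>D\<in>set Ds. is_deriv G D; rule_inst G (map concl Ds) \<sigma> \<rbrakk> \<Longrightarrow> is_deriv G (Der Ds \<sigma>)"

definition is_deriv_of_goal :: "form \<Rightarrow> deriv \<Rightarrow> bool" where
  "is_deriv_of_goal G D \<longleftrightarrow> is_deriv G D \<and> (\<exists>\<Gamma>. concl D = Reg \<Gamma> G)"

primrec nodes :: "deriv \<Rightarrow> deriv set" where
  "nodes (Der Ds \<sigma>) = insert (Der Ds \<sigma>) (\<Union> (set (map nodes Ds)))"

definition p_sequents :: "form \<Rightarrow> deriv \<Rightarrow> sequent set" where
  "p_sequents G D =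
     {\<sigma>. regular \<sigma> \<and>
         (\<exists>Ds. Der Ds \<sigma> \<in> nodes D \<and>
               (Ds = [] \<and> ax_schema G \<sigma> \<or> join_schema G (map concl Ds) \<sigma>))}"

text \<open>The relation \<open>\<mapsto>\<^sub>0\<close> is generated by the rule instances occurring in \<open>D\<close>. If all instances of
  the calculus were admitted, worlds unrelated in \<open>D\<close> could become comparable. For example, let
  \<open>G = ((q \<supset> r) \<or> (p \<supset> q \<or> s)) \<or> (u \<supset> p \<or> v)\<close>. Every derivation of \<open>G\<close> contains the p-sequents
  \<open>p,q,u \<Rightarrow> r\<close> and \<open>p,u \<Rightarrow> q \<or> s\<close>. The second can be obtained from irregular axioms alone, but also
  by a join with the additional premise \<open>\<emptyset>; p,u \<rightarrow> q \<supset> r\<close>, which comes from the first. The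
  models of all derivations of \<open>G\<close> would then have height at least 2, whereas \<open>G\<close> has a countermodel
  of height 1.\<close>

definition step :: "deriv \<Rightarrow> sequent \<Rightarrow> sequent \<Rightarrow> bool" where
  "step D \<sigma>1 \<sigma>2 \<longleftrightarrow> (\<exists>Ds. Der Ds \<sigma>2 \<in> nodes D \<and> \<sigma>1 \<in> set (map concl Ds))"

definition p_le :: "deriv \<Rightarrow> sequent \<Rightarrow> sequent \<Rightarrow> bool" where
  "p_le D \<sigma>1 \<sigma>2 \<longleftrightarrow> (step D)\<^sup>*\<^sup>* \<sigma>2 \<sigma>1"

definition Mod :: "form \<Rightarrow> deriv \<Rightarrow> sequent kripke" where
  "Mod G D =
     \<lparr>worlds = p_sequents G D,
      le = p_le D,
      root = (THE \<rho>. \<rho> \<in> p_sequents G D \<and> (\<forall>\<sigma>\<in>p_sequents G D. p_le D \<rho> \<sigma>)),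
      val = (\<lambda>\<sigma>. {p. Var p \<in> Lhs \<sigma>})\<rparr>"

end

(* A finite countermodel K of minimal height is turned into a derivation: by induction on the height
   of a world w and on the refuted formula C, one obtains Gamma => C and Sigma; Theta -> C whose
   left-hand sides approximate the set core of w (core in Cl Gamma, resp. Sigma in core in
   Sigma Un Theta), where each passage from w to a higher world is one use of imp_notin. Hence the
   nesting depth of the derivation is at most the height of K. Deriving each sequent always by the
   same rule instance of least depth, chains of worlds in the extracted model have at most that
   length. Conversely, the extracted model of any derivation of G is a countermodel for G, so its
   height cannot be smaller. *)

theory Submission
  imports Defs
begin

text \<open>The obstacle is that the worlds of \<open>Mod G D\<close> are sequents and not nodes of
  the tree. Several occurrences of a sequent become one world, and a path of \<open>step D\<close>
  may arrive at one occurrence and continue from another. Counting \<open>imp_notin\<close>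
  inferences on the branches of a tree therefore does not bound chains of worlds. A number attached
  to the sequent itself does: along the chosen rule instances \<open>depth\<close> never grows from
  conclusion to premise, and it drops whenever a regular premise has an irregular conclusion. In the
  resulting derivation every premise of a world is irregular, so two distinct comparable worlds are
  always separated by such a drop.\<close>

lemma minimal_subset_ex:
  assumes "finite B" "P B"
  shows "\<exists>X\<subseteq>B. P X \<and> (\<forall>Y. Y \<subset> X \<longrightarrow> \<not> P Y)"
  using assms
proof (induction rule: finite_psubset_induct)
  case (psubset B)
  show ?case
  proof (cases "\<exists>Y. Y \<subset> B \<and> P Y")
    case True
    then obtain Y where Y: "Y \<subset> B" "P Y" by blast
    from psubset.IH[OF this] show ?thesis using Y(1) by (meson order_trans psubset_imp_subset)
  next
    case False
    then show ?thesis using psubset.prems by blast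
  qed
qed

lemma maximal_superset_ex:
  assumes "finite U" "X \<subseteq> U" "P X"
  shows "\<exists>Y\<subseteq>U. X \<subseteq> Y \<and> P Y \<and> (\<forall>Z. Y \<subset> Z \<and> Z \<subseteq> U \<longrightarrow> \<not> P Z)"
proof -
  obtain Y where "Y \<in> {Y \<in> Pow U. P Y}" "X \<subseteq> Y" "\<forall>Z\<in>{Y \<in> Pow U. P Y}. Y \<subseteq> Z \<longrightarrow> Y = Z"
    using finite_has_maximal2[of "{Y \<in> Pow U. P Y}" X] assms by auto
  then show ?thesis by (intro exI[of _ Y]) auto
qed

subsection \<open>Finite countermodels\<close>

lemma nd_cut: "nd X A \<Longrightarrow> nd (insert A X) B \<Longrightarrow> nd X B"
  by (meson nd_impE nd_impI)

primrec subfs :: "form \<Rightarrow> form set" where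
  "subfs (Var p) = {Var p}"
| "subfs Bot = {Bot}"
| "subfs (And A B) = insert (And A B) (subfs A \<union> subfs B)"
| "subfs (Or A B) = insert (Or A B) (subfs A \<union> subfs B)"
| "subfs (Imp A B) = insert (Imp A B) (subfs A \<union> subfs B)"

lemma finite_subfs [simp]: "finite (subfs A)"
  by (induction A) auto

lemma subfs_refl [simp]: "A \<in> subfs A"
  by (cases A) auto

lemma subfs_closed:
  "And A B \<in> subfs G \<Longrightarrow> A \<in> subfs G \<and> B \<in> subfs G"
  "Or A B \<in> subfs G \<Longrightarrow> A \<in> subfs G \<and> B \<in> subfs G"
  "Imp A B \<in> subfs G \<Longrightarrow> A \<in> subfs G \<and> B \<in> subfs G"
  by (induction G) auto

text \<open>Deductive closure is relative to \<open>S\<close>; for finite \<open>S\<close> only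
  finitely many theories arise, which makes the canonical model finite.\<close>

definition prime_theory :: "form set \<Rightarrow> form set \<Rightarrow> bool" where
  "prime_theory S X \<longleftrightarrow>
     X \<subseteq> S \<and> \<not> nd X Bot \<and> (\<forall>A\<in>S. nd X A \<longrightarrow> A \<in> X) \<and>
     (\<forall>A B. Or A B \<in> X \<longrightarrow> A \<in> X \<or> B \<in> X)"

text \<open>A subset of \<open>subfs G\<close> maximal among those not deriving \<open>C\<close>
  works: adding any missing subformula makes \<open>C\<close> derivable, which gives deductive
  closure by cut and primeness by disjunction elimination.\<close>

lemma prime_extension:
  assumes "X \<subseteq> subfs G" "\<not> nd X C"
  obtains Y where "X \<subseteq> Y" "prime_theory (subfs G) Y" "\<not> nd Y C"
proof -
  obtain Y where Y: "Y \<subseteq> subfs G" "X \<subseteq> Y" "\<not> nd Y C"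
    and max: "\<forall>Z. Y \<subset> Z \<and> Z \<subseteq> subfs G \<longrightarrow> \<not> \<not> nd Z C"
    using maximal_superset_ex[of "subfs G" X "\<lambda>Y. \<not> nd Y C", OF finite_subfs assms]
    by (elim exE conjE)
  have ins: "nd (insert A Y) C" if "A \<in> subfs G" "A \<notin> Y" for A
    using max[THEN spec, of "insert A Y"] Y that by auto
  have "A \<in> Y" if "A \<in> subfs G" "nd Y A" for A
    using ins[OF that(1)] that(2) Y by (blast dest: nd_cut)
  moreover have "\<not> nd Y Bot" using Y by (blast intro: nd_botE)
  moreover have "A \<in> Y \<or> B \<in> Y" if "Or A B \<in> Y" for A B
    using that Y ins[of A] ins[of B] subfs_closed(2)[of A B G]
    by (blast intro: nd_orE nd_ass)
  ultimately show thesis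
    using that Y by (auto simp: prime_theory_def)
qed

text \<open>The canonical model over the subformulas of \<open>G\<close>. It ensures that the
  minimum in \<open>min_height\<close> is taken over a nonempty set.\<close>

lemma finite_countermodel:
  assumes "G \<notin> IPL"
  shows "\<exists>K :: form set kripke. countermodel K G"
proof -
  have "\<not> nd {} G" using assms by (simp add: IPL_def)
  then obtain X0 where X0: "prime_theory (subfs G) X0" "\<not> nd X0 G"
    using prime_extension[of "{}" G G] by auto
  define K where "K = \<lparr>worlds = {X. prime_theory (subfs G) X \<and> X0 \<subseteq> X}, le = (\<subseteq>),
    root = X0, val = (\<lambda>X. {p. Var p \<in> X})\<rparr>"
  have "finite (worlds K)"
    by (rule finite_subset[of _ "Pow (subfs G)"]) (auto simp: K_def prime_theory_def)
  then have "kripke_model K"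
    using X0 by (auto simp: kripke_model_def K_def reflp_on_def antisymp_on_def transp_on_def)
  moreover have truth: "forces K X A \<longleftrightarrow> A \<in> X" if "A \<in> subfs G" "X \<in> worlds K" for A X
    using that
  proof (induction A arbitrary: X)
    case (Var p)
    then show ?case by (simp add: K_def)
  next
    case Bot
    then show ?case by (auto simp: K_def prime_theory_def intro: nd_ass)
  next
    case (And A B)
    then have sub: "A \<in> subfs G" "B \<in> subfs G" using subfs_closed by blast+
    have "And A B \<in> X \<longleftrightarrow> A \<in> X \<and> B \<in> X"
      using And.prems sub unfolding K_def prime_theory_def
      by simp (meson nd_andE1 nd_andE2 nd_andI nd_ass)
    then show ?case using And sub by simp
  next
    case (Or A B)
    then have sub: "A \<in> subfs G" "B \<in> subfs G" using subfs_closed by blast+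
    have "Or A B \<in> X \<longleftrightarrow> A \<in> X \<or> B \<in> X"
      using Or.prems sub unfolding K_def prime_theory_def
      by simp (meson nd_orI1 nd_orI2 nd_ass)
    then show ?case using Or sub by simp
  next
    case (Imp A B)
    then have sub: "A \<in> subfs G" "B \<in> subfs G" using subfs_closed by blast+
    have X: "prime_theory (subfs G) X" "X0 \<subseteq> X" using Imp.prems by (auto simp: K_def)
    show ?case
    proof
      assume f: "forces K X (Imp A B)"
      have "nd (insert A X) B"
      proof (rule ccontr)
        assume *: "\<not> nd (insert A X) B"
        have "insert A X \<subseteq> subfs G" using X sub by (auto simp: prime_theory_def)
        from this * obtain Y where "insert A X \<subseteq> Y" "prime_theory (subfs G) Y" "\<not> nd Y B"
          by (rule prime_extension)
        moreover from this have "Y \<in> worlds K" using X by (auto simp: K_def)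
        ultimately show False
          using f Imp.IH sub nd_ass by (auto simp: K_def)
      qed
      then show "Imp A B \<in> X"
        using X Imp.prems by (auto simp: prime_theory_def intro: nd_impI)
    next
      assume "Imp A B \<in> X"
      then have "B \<in> Y" if "Y \<in> worlds K" "X \<subseteq> Y" "A \<in> Y" for Y
        using that sub unfolding K_def prime_theory_def
        by simp (meson nd_ass nd_impE subsetD)
      then show "forces K X (Imp A B)"
        using Imp.IH sub by (simp add: K_def)
    qed
  qed
  moreover have "\<not> forces K (root K) G"
    using truth[of G X0] X0 nd_ass by (auto simp: K_def)
  ultimately show ?thesis by (auto simp: countermodel_def)
qed

subsection \<open>Kripke models\<close>

lemma forces_persistent:
  assumes K: "kripke_model K" and "v \<in> worlds K" "w \<in> worlds K" "le K v w" "forces K v A"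
  shows "forces K w A"
  using assms(2-)
proof (induction A)
  case (Var p)
  then show ?case using K by (auto simp: kripke_model_def)
next
  case (Imp A B)
  have "transp_on (worlds K) (le K)" using K by (simp add: kripke_model_def)
  then show ?case using Imp.prems by (auto dest: transp_onD)
qed auto

lemma le_refl: "kripke_model K \<Longrightarrow> w \<in> worlds K \<Longrightarrow> le K w w"
  by (auto simp: kripke_model_def dest: reflp_onD)

lemma forces_Cl:
  assumes K: "kripke_model K" "w \<in> worlds K" and "\<forall>X\<in>\<Gamma>. forces K w X" and "A \<in> Cl \<Gamma>"
  shows "forces K w A"
  using assms(4)
proof induction
  case (Cl_imp B A)
  then show ?case using K forces_persistent by auto
qed (use assms in auto)

lemma height_above:
  assumes "kripke_model K" "w \<in> worlds K" "v \<in> above K w"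
  shows "height K v < height K w"
proof -
  have "finite (above K w)" using assms by (simp add: above_def kripke_model_def)
  then have "height K v \<le> Max (height K ` above K w)" using assms by simp
  then show ?thesis using assms by (auto simp: height_rec)
qed

text \<open>Used for the extracted model with \<open>f\<close> the depth of a sequent.\<close>

lemma height_le:
  assumes K: "kripke_model K" and w: "w \<in> worlds K"
    and f: "\<And>w v. w \<in> worlds K \<Longrightarrow> v \<in> above K w \<Longrightarrow> f v < f w"
  shows "height K w \<le> f w"
  using w
proof (induction "f w" arbitrary: w rule: less_induct)
  case less
  have fin: "finite (above K w)" using K by (simp add: above_def kripke_model_def)
  have "Suc (height K v) \<le> f w" if "v \<in> above K w" for v
    using less.hyps[of v] f[OF less.prems that] that by (auto simp: above_def)
  then show ?case
    using fin by (cases "above K w = {}") (auto simp: height_rec[OF K less.prems] Suc_le_eq)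
qed

subsection \<open>Closures and signed subformulas\<close>

lemma Cl_least: "X \<subseteq> Cl Y \<Longrightarrow> Cl X \<subseteq> Cl Y"
proof
  fix A assume "A \<in> Cl X" "X \<subseteq> Cl Y"
  then show "A \<in> Cl Y" by induction (auto intro: Cl.intros)
qed

lemma Cl_extensive: "X \<subseteq> Cl X"
  by (auto intro: Cl_base)

lemma subset_ClI: "X \<subseteq> Y \<Longrightarrow> X \<subseteq> Cl Y"
  by (auto intro: Cl_base)

lemma Cl_mono: "X \<subseteq> Y \<Longrightarrow> Cl X \<subseteq> Cl Y"
  using Cl_extensive by (intro Cl_least) auto

lemma Var_in_Cl [simp]: "Var p \<in> Cl X \<longleftrightarrow> Var p \<in> X"
  by (auto intro: Cl_base elim: Cl.cases)

lemma Sl_subfs: "A \<in> Sl G \<Longrightarrow> A \<in> subfs G"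
  and Sr_subfs: "B \<in> Sr G \<Longrightarrow> B \<in> subfs G"
  by (induction rule: Sl_Sr.inducts) (blast intro: subfs_refl dest: subfs_closed)+

lemma finite_GBar: "finite (GBar G)"
  by (rule finite_subset[of _ "subfs G"])
    (auto simp: GBar_def GAt_def GImp_def Sl_subfs)

lemma GBar_cases: "GBar G = Sl G \<inter> (Vars \<union> Imps)"
  by (auto simp: GBar_def GAt_def GImp_def)

subsection \<open>Derivability with bounded nesting\<close>

text \<open>Only \<open>imp_notin\<close> has a regular premise and an irregular conclusion, so
  \<open>jump\<close> is 1 exactly at its instances.\<close>

definition jump :: "sequent \<Rightarrow> sequent \<Rightarrow> nat" where
  "jump \<tau> \<sigma> = (if regular \<tau> \<and> \<not> regular \<sigma> then 1 else 0)"

text \<open>\<open>drv G n \<sigma>\<close> bounds the number of \<open>\<supset>\<^sub>\<notin>\<close> inferences on each branch by \<open>n\<close>: these are the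
  steps in which the extracted model moves to a strictly smaller world.\<close>

inductive drv :: "form \<Rightarrow> nat \<Rightarrow> sequent \<Rightarrow> bool" for G :: form where
  drvI: "\<lbrakk> rule_inst G \<pi> \<sigma>; \<forall>\<tau>\<in>set \<pi>. \<exists>m. drv G m \<tau> \<and> m + jump \<tau> \<sigma> \<le> n \<rbrakk> \<Longrightarrow> drv G n \<sigma>"

lemma drv_mono:
  assumes "drv G m \<sigma>" "m \<le> n"
  shows "drv G n \<sigma>"
  using assms(1)
proof cases
  case (drvI \<pi>)
  have "\<forall>\<tau>\<in>set \<pi>. \<exists>k. drv G k \<tau> \<and> k + jump \<tau> \<sigma> \<le> n"
    using drvI(2) assms(2) by (meson order_trans)
  with drvI(1) show ?thesis by (rule drv.drvI)
qed

lemma drv_is_sequent: "drv G n \<sigma> \<Longrightarrow> is_sequent G \<sigma>"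
  by (auto elim: drv.cases simp: rule_inst_def)

lemma drv_axiom: "ax_schema G \<sigma> \<Longrightarrow> is_sequent G \<sigma> \<Longrightarrow> drv G n \<sigma>"
  by (rule drvI[of G "[]"]) (auto simp: rule_inst_def)

lemma drv_logical:
  assumes "logical_schema G \<pi> \<sigma>" "is_sequent G \<sigma>"
    and "\<And>\<tau>. \<tau> \<in> set \<pi> \<Longrightarrow> drv G n \<tau> \<and> (regular \<tau> \<longrightarrow> regular \<sigma>)"
  shows "drv G n \<sigma>"
  using assms
  by (intro drvI[of G \<pi>]) (auto simp: rule_inst_def jump_def intro: drv_is_sequent)

lemma drv_imp_notin:
  assumes "logical_schema G [Reg \<Gamma> B] (Irr {} \<Theta> C)" "is_sequent G (Irr {} \<Theta> C)"
    and "drv G m (Reg \<Gamma> B)" "m < n"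
  shows "drv G n (Irr {} \<Theta> C)"
  using assms
  by (intro drvI[of G "[Reg \<Gamma> B]"])
    (auto simp: rule_inst_def jump_def Suc_le_eq intro: drv_is_sequent)

lemma drv_join:
  assumes "join_schema G (join_prems k \<Sigma> \<Theta> A) \<sigma>" "is_sequent G \<sigma>"
    and "\<And>j. j < k \<Longrightarrow> drv G n (Irr (\<Sigma> j) (\<Theta> j) (A j))"
  shows "drv G n \<sigma>"
  using assms
  by (intro drvI[of G "join_prems k \<Sigma> \<Theta> A"])
    (force simp: rule_inst_def jump_def join_prems_def intro: drv_is_sequent)+

subsection \<open>From countermodels to derivations\<close>

text \<open>The forced implications with a forced antecedent \<open>Y\<close> are left out, since the join rules can
  only keep \<open>Y \<supset> Z\<close> if \<open>Y\<close> is refuted; they are recovered from \<open>Z\<close> in the closure.\<close>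

definition core :: "form \<Rightarrow> 'w kripke \<Rightarrow> 'w \<Rightarrow> form set" where
  "core G K w = {X \<in> Sl G. forces K w X \<and>
     (X \<in> Vars \<or> (\<exists>Y Z. X = Imp Y Z \<and> \<not> forces K w Y))}"

lemma core_GBar: "core G K w \<subseteq> GBar G"
  by (auto simp: core_def GBar_cases Imps_def)

lemma finite_core: "finite (core G K w)"
  using core_GBar finite_GBar by (rule finite_subset)

lemma core_forces: "X \<in> core G K w \<Longrightarrow> forces K w X"
  by (simp add: core_def)

text \<open>With \<open>forces_Cl_core\<close>, a formula of \<open>Sl G\<close> lies in this
  closure iff it is forced; side conditions on \<open>Cl\<close> are thereby read off from the
  model.\<close>

lemma forced_in_Cl_core:
  assumes K: "kripke_model K" "w \<in> worlds K" and "A \<in> Sl G" "forces K w A"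
  shows "A \<in> Cl (core G K w)"
  using assms(3,4)
proof (induction A rule: form.induct)
  case (Var p)
  then show ?case by (simp add: core_def Vars_def)
next
  case (And A B)
  then show ?case using Sl_and1[OF And.prems(1)] Sl_and2[OF And.prems(1)] by (auto intro: Cl_and)
next
  case (Or A B)
  then show ?case using Sl_or1[OF Or.prems(1)] Sl_or2[OF Or.prems(1)] by (auto intro: Cl_or1 Cl_or2)
next
  case (Imp A B)
  show ?case
  proof (cases "forces K w A")
    case True
    then have "forces K w B" using Imp.prems(2) K(2) le_refl[OF K] by simp
    then show ?thesis using Imp.IH(2) Sl_imp1[OF Imp.prems(1)] by (simp add: Cl_imp)
  next
    case False
    then show ?thesis using Imp.prems by (auto simp: core_def intro!: Cl_base)
  qed
qed auto

lemma forces_Cl_core: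
  "kripke_model K \<Longrightarrow> w \<in> worlds K \<Longrightarrow> A \<in> Cl (core G K w) \<Longrightarrow> forces K w A"
  by (rule forces_Cl[where \<Gamma> = "core G K w"]) (auto simp: core_forces)

text \<open>The closure is essential: an implication leaves the core as soon as its antecedent
  becomes forced.\<close>

lemma core_subset_Cl_above:
  assumes "kripke_model K" "w \<in> worlds K" "v \<in> worlds K" "le K w v"
  shows "core G K w \<subseteq> Cl (core G K v)"
proof
  fix X assume "X \<in> core G K w"
  then have "X \<in> Sl G" "forces K v X"
    using forces_persistent[OF assms core_forces] by (auto simp: core_def)
  then show "X \<in> Cl (core G K v)" by (rule forced_in_Cl_core[OF assms(1,3)])
qed

text \<open>If \<open>A\<close> were forced at \<open>w\<close>, so would be \<open>B\<close> by the
  last assumption, and persistence would force \<open>B\<close> at \<open>v\<close>. That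
  \<open>A\<close> is refuted at \<open>w\<close> later yields the condition
  \<open>A \<notin> Cl \<Theta>\<close> of \<open>imp_notin\<close>.\<close>

lemma Imp_not_forced:
  assumes "kripke_model K" "w \<in> worlds K" "\<not> forces K w (Imp A B)"
    and "\<not> (forces K w A \<and> \<not> forces K w B)"
  obtains v where "v \<in> above K w" "forces K v A" "\<not> forces K v B" "\<not> forces K w A"
proof -
  obtain v where v: "v \<in> worlds K" "le K w v" "forces K v A" "\<not> forces K v B"
    using assms(3) by auto
  then have "v \<in> above K w" using assms(4) by (auto simp: above_def)
  moreover have "\<not> forces K w A"
    using forces_persistent[OF assms(1,2) v(1,2), of A] v(1-3) assms(4)
      forces_persistent[OF assms(1,2) v(1,2), of B] v(4) by blast
  ultimately show thesis using v that by blast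
qed

text \<open>The two-sided bound makes all sequents found for \<open>w\<close> compatible: each
  \<open>\<Sigma>\<close> lies in the core, which lies in the left-hand side of any other. The
  inclusions required by \<open>or_irr\<close> and by the joins then hold automatically, so premises
  can be chosen independently.\<close>

lemma irregular_complete:
  assumes K: "kripke_model K" "w \<in> worlds K"
    and above: "\<And>v C. \<lbrakk> v \<in> above K w; C \<in> Sr G; \<not> forces K v C \<rbrakk> \<Longrightarrow>
      \<exists>\<Gamma>. drv G (height K v) (Reg \<Gamma> C) \<and> core G K v \<subseteq> Cl \<Gamma>"
    and "C \<in> Sr G" "\<not> forces K w C"
  shows "\<exists>\<Sigma> \<Theta>. drv G (height K w) (Irr \<Sigma> \<Theta> C) \<and> \<Sigma> \<subseteq> core G K w \<and> core G K w \<subseteq> \<Sigma> \<union> \<Theta>"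
proof -
  let ?c = "core G K w" and ?h = "height K w"
  have atom: "\<exists>\<Sigma> \<Theta>. drv G ?h (Irr \<Sigma> \<Theta> F) \<and> \<Sigma> \<subseteq> ?c \<and> ?c \<subseteq> \<Sigma> \<union> \<Theta>"
    if "F \<in> VarsBot" "F \<in> Sr G" "\<not> forces K w F" for F
  proof (intro exI conjI)
    show "drv G ?h (Irr {} ((GAt G - {F}) \<union> GImp G) F)"
      using that by (intro drv_axiom ax_irr) (auto simp: is_sequent_def GBar_def)
    show "?c \<subseteq> {} \<union> ((GAt G - {F}) \<union> GImp G)"
      using core_GBar[of G K w] that(3) core_forces[of F G K w] by (auto simp: GBar_def)
  qed simp
  from assms(4,5) show ?thesis
  proof (induction C rule: form.induct)
    case (Var p)
    then show ?case by (intro atom) (auto simp: VarsBot_def Vars_def)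
  next
    case Bot
    then show ?case by (intro atom) (auto simp: VarsBot_def)
  next
    case (And A B)
    then obtain C \<Sigma> \<Theta> where C: "C \<in> {A, B}"
      and 1: "drv G ?h (Irr \<Sigma> \<Theta> C)" "\<Sigma> \<subseteq> ?c" "?c \<subseteq> \<Sigma> \<union> \<Theta>"
      using Sr_and1 Sr_and2 by (metis forces.simps(3) insertCI)
    have "drv G ?h (Irr \<Sigma> \<Theta> (And A B))"
      using 1(1) drv_is_sequent[OF 1(1)] And.prems
      by (intro drv_logical[OF and_irr[OF C]]) (auto simp: is_sequent_def)
    then show ?case using 1 by blast
  next
    case (Or A B)
    then obtain \<Sigma>1 \<Theta>1 where 1: "drv G ?h (Irr \<Sigma>1 \<Theta>1 A)" "\<Sigma>1 \<subseteq> ?c" "?c \<subseteq> \<Sigma>1 \<union> \<Theta>1"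
      using Sr_or1 by (metis forces.simps(4))
    obtain \<Sigma>2 \<Theta>2 where 2: "drv G ?h (Irr \<Sigma>2 \<Theta>2 B)" "\<Sigma>2 \<subseteq> ?c" "?c \<subseteq> \<Sigma>2 \<union> \<Theta>2"
      using Or Sr_or2 by (metis forces.simps(4))
    have "drv G ?h (Irr (\<Sigma>1 \<union> \<Sigma>2) (\<Theta>1 \<inter> \<Theta>2) (Or A B))"
    proof (rule drv_logical[OF or_irr])
      show "is_sequent G (Irr (\<Sigma>1 \<union> \<Sigma>2) (\<Theta>1 \<inter> \<Theta>2) (Or A B))"
        using drv_is_sequent[OF 1(1)] drv_is_sequent[OF 2(1)] Or.prems
        by (auto simp: is_sequent_def)
    qed (use 1 2 in auto)
    moreover have "?c \<subseteq> (\<Sigma>1 \<union> \<Sigma>2) \<union> (\<Theta>1 \<inter> \<Theta>2)" using 1 2 by blast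
    ultimately show ?case using 1 2 by blast
  next
    case (Imp A B)
    have sr: "A \<in> Sl G" "B \<in> Sr G" using Imp.prems Sr_imp1 Sr_imp2 by blast+
    show ?case
    proof (cases "forces K w A \<and> \<not> forces K w B")
      case True
      then obtain \<Sigma> \<Theta> where 1: "drv G ?h (Irr \<Sigma> \<Theta> B)" "\<Sigma> \<subseteq> ?c" "?c \<subseteq> \<Sigma> \<union> \<Theta>"
        using Imp.IH sr by blast
      have "A \<in> Cl ?c" using forced_in_Cl_core[OF K sr(1)] True by blast
      moreover have "?c = \<Sigma> \<union> (?c \<inter> \<Theta>)" using 1 by blast
      ultimately have "A \<in> Cl (\<Sigma> \<union> (?c \<inter> \<Theta>))" by simp
      \<comment> \<open>Searching inside \<open>?c \<inter> \<Theta>\<close> instead of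
        \<open>\<Theta>\<close> keeps \<open>\<Sigma> \<union> \<Lambda>\<close> within the
        core.\<close>
      then obtain \<Lambda> where L: "\<Lambda> \<subseteq> ?c \<inter> \<Theta>" "A \<in> Cl (\<Sigma> \<union> \<Lambda>)"
        and min: "\<forall>\<Lambda>'. \<Lambda>' \<subset> \<Lambda> \<longrightarrow> A \<notin> Cl (\<Sigma> \<union> \<Lambda>')"
        using minimal_subset_ex[of "?c \<inter> \<Theta>" "\<lambda>L. A \<in> Cl (\<Sigma> \<union> L)"] finite_core[of G K w]
        by auto
      have eq: "\<Theta> = (\<Theta> - \<Lambda>) \<union> \<Lambda>" using L by blast
      have "logical_schema G [Irr \<Sigma> ((\<Theta> - \<Lambda>) \<union> \<Lambda>) B] (Irr (\<Sigma> \<union> \<Lambda>) (\<Theta> - \<Lambda>) (Imp A B))"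
        using L min by (intro imp_in_irr) auto
      then have "logical_schema G [Irr \<Sigma> \<Theta> B] (Irr (\<Sigma> \<union> \<Lambda>) (\<Theta> - \<Lambda>) (Imp A B))"
        using eq by simp
      then have "drv G ?h (Irr (\<Sigma> \<union> \<Lambda>) (\<Theta> - \<Lambda>) (Imp A B))"
        by (rule drv_logical)
          (use 1 L drv_is_sequent[OF 1(1)] Imp.prems in \<open>auto simp: is_sequent_def\<close>)
      moreover have "\<Sigma> \<union> \<Lambda> \<subseteq> ?c" "?c \<subseteq> (\<Sigma> \<union> \<Lambda>) \<union> (\<Theta> - \<Lambda>)" using 1 L by blast+
      ultimately show ?thesis by blast
    next
      case False
      from Imp_not_forced[OF K Imp.prems(2) this]
      obtain v where v: "v \<in> above K w" "forces K v A" "\<not> forces K v B" "\<not> forces K w A" .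
      then have vw: "v \<in> worlds K" "le K w v" by (auto simp: above_def)
      from above[OF v(1) sr(2) v(3)]
      obtain \<Gamma> where G: "drv G (height K v) (Reg \<Gamma> B)" "core G K v \<subseteq> Cl \<Gamma>" by blast
      then have Cl: "Cl (core G K v) \<subseteq> Cl \<Gamma>" by (intro Cl_least)
      have A: "A \<in> Cl \<Gamma>" using forced_in_Cl_core[OF K(1) vw(1) sr(1) v(2)] Cl by blast
      have "?c \<subseteq> Cl \<Gamma> \<inter> GBar G"
        using core_subset_Cl_above[OF K vw, of G] Cl core_GBar[of G K w] by blast
      moreover have "A \<notin> Cl ?c" using forces_Cl_core[OF K] v(4) by blast
      moreover have "finite (Cl \<Gamma> \<inter> GBar G)" using finite_GBar by simp
      \<comment> \<open>\<open>imp_notin\<close> demands a maximal \<open>\<Theta>\<close>;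
        enlarging the core is harmless because \<open>\<Sigma>\<close> is empty and only
        \<open>?c \<subseteq> \<Theta>\<close> has to be kept.\<close>
      ultimately obtain \<Theta> where T: "\<Theta> \<subseteq> Cl \<Gamma> \<inter> GBar G" "?c \<subseteq> \<Theta>" "A \<notin> Cl \<Theta>"
        and max: "\<forall>Z. \<Theta> \<subset> Z \<and> Z \<subseteq> Cl \<Gamma> \<inter> GBar G \<longrightarrow> \<not> A \<notin> Cl Z"
        using maximal_superset_ex[of "Cl \<Gamma> \<inter> GBar G" ?c "\<lambda>T. A \<notin> Cl T"] by auto
      have "drv G ?h (Irr {} \<Theta> (Imp A B))"
      proof (rule drv_imp_notin[OF imp_notin])
        show "is_sequent G (Irr {} \<Theta> (Imp A B))"
          using T Imp.prems by (auto simp: is_sequent_def)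
        show "height K v < ?h" by (rule height_above[OF K v(1)])
      qed (use A T max G in auto)
      then show ?thesis using T by blast
    qed
  qed
qed

text \<open>\<open>\<Delta>\<close> will be the core. A member of \<open>\<Delta>\<close> that
  occurs in no \<open>\<Sigma> j\<close> belongs to every \<open>\<Theta> j\<close> and survives in
  the intersection, provided that the antecedents of implications in \<open>\<Delta>\<close> are
  among the right formulas \<open>U\<close>.\<close>

lemma join_ex:
  assumes U: "finite U" "U \<noteq> {}"
    and prem: "\<forall>Y\<in>U. \<exists>\<Sigma> \<Theta>. drv G m (Irr \<Sigma> \<Theta> Y) \<and> \<Sigma> \<subseteq> \<Delta> \<and> \<Delta> \<subseteq> \<Sigma> \<union> \<Theta>"
    and imp: "\<forall>Y Z. Imp Y Z \<in> \<Delta> \<longrightarrow> Y \<in> U" and \<Delta>: "\<Delta> \<subseteq> Vars \<union> Imps"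
  obtains n \<Sigma> \<Theta> A where "Ups n A = U" "join_cond n \<Sigma> \<Theta> A"
    "\<And>j. j < n \<Longrightarrow> drv G m (Irr (\<Sigma> j) (\<Theta> j) (A j))"
    "SigAt n \<Sigma> \<subseteq> \<Delta>" "\<Delta> \<subseteq> SigAt n \<Sigma> \<union> ThAt n \<Theta> \<union> SigImp n \<Sigma> \<union> ThImp n \<Theta> A"
    "SigAt n \<Sigma> \<union> ThAt n \<Theta> \<union> SigImp n \<Sigma> \<union> ThImp n \<Theta> A \<subseteq> GBar G"
proof -
  obtain n A where A: "U = A ` {i::nat. i < n}"
    using finite_imp_nat_seg_image_inj_on[OF U(1)] by blast
  then have Ups: "Ups n A = U" by (auto simp: Ups_def)
  have n: "n \<ge> 1" using U A by (cases n) auto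
  have "\<forall>j. \<exists>\<Sigma> \<Theta>. j < n \<longrightarrow> drv G m (Irr \<Sigma> \<Theta> (A j)) \<and> \<Sigma> \<subseteq> \<Delta> \<and> \<Delta> \<subseteq> \<Sigma> \<union> \<Theta>"
    using prem A by blast
  then obtain \<Sigma> \<Theta> where st: "\<And>j. j < n \<Longrightarrow> drv G m (Irr (\<Sigma> j) (\<Theta> j) (A j))"
    "\<And>j. j < n \<Longrightarrow> \<Sigma> j \<subseteq> \<Delta>" "\<And>j. j < n \<Longrightarrow> \<Delta> \<subseteq> \<Sigma> j \<union> \<Theta> j"
    by metis
  have sub: "\<Sigma> j \<union> \<Theta> j \<subseteq> GBar G" if "j < n" for j
    using drv_is_sequent[OF st(1)[OF that]] by (simp add: is_sequent_def)
  show thesis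
  proof (rule that)
    have "\<Sigma> i \<subseteq> \<Sigma> j \<union> \<Theta> j" if "i < n" "j < n" for i j
      using st(2)[OF that(1)] st(3)[OF that(2)] by blast
    moreover have "Y \<in> U" if "Imp Y Z \<in> SigImp n \<Sigma>" for Y Z
      using that st(2) imp by (auto simp: SigImp_def)
    ultimately show "join_cond n \<Sigma> \<Theta> A"
      using n by (simp add: join_cond_def Ups)
    show "SigAt n \<Sigma> \<subseteq> \<Delta>" using st(2) by (auto simp: SigAt_def)
    show "\<Delta> \<subseteq> SigAt n \<Sigma> \<union> ThAt n \<Theta> \<union> SigImp n \<Sigma> \<union> ThImp n \<Theta> A"
    proof
      fix X assume X: "X \<in> \<Delta>"
      show "X \<in> SigAt n \<Sigma> \<union> ThAt n \<Theta> \<union> SigImp n \<Sigma> \<union> ThImp n \<Theta> A"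
      proof (cases "\<exists>j<n. X \<in> \<Sigma> j")
        case True
        then show ?thesis using X \<Delta> by (auto simp: SigAt_def SigImp_def)
      next
        case False
        then have T: "\<forall>j<n. X \<in> \<Theta> j" using st(3) X by blast
        consider "X \<in> Vars" | Y Z where "X = Imp Y Z" using X \<Delta> by (auto simp: Imps_def)
        then show ?thesis
        proof cases
          case 1
          with T show ?thesis by (simp add: ThAt_def)
        next
          case 2
          with T X imp show ?thesis by (auto simp: ThImp_def Imps_def Ups)
        qed
      qed
    qed
    have n0: "0 < n" using n by simp
    then have "ThAt n \<Theta> \<subseteq> \<Theta> 0" "ThImp n \<Theta> A \<subseteq> \<Theta> 0"
      unfolding ThAt_def ThImp_def by blast+
    moreover have "\<Theta> 0 \<subseteq> GBar G" using sub[OF n0] by blast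
    moreover have "SigAt n \<Sigma> \<subseteq> GBar G" "SigImp n \<Sigma> \<subseteq> GBar G"
      using sub unfolding SigAt_def SigImp_def by blast+
    ultimately show "SigAt n \<Sigma> \<union> ThAt n \<Theta> \<union> SigImp n \<Sigma> \<union> ThImp n \<Theta> A \<subseteq> GBar G"
      by blast
  qed (use Ups st(1) in auto)
qed

text \<open>At each world the irregular sequents come first, from regular ones at higher worlds; the
  joins then give the regular ones. \<open>\<Gamma>\<close> is bounded from below only, since in the
  implication case it may belong to a higher world.\<close>

lemma regular_complete:
  assumes K: "kripke_model K" and "w \<in> worlds K" "C \<in> Sr G" "\<not> forces K w C"
  shows "\<exists>\<Gamma>. drv G (height K w) (Reg \<Gamma> C) \<and> core G K w \<subseteq> Cl \<Gamma>"
  using assms(2-)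
proof (induction "height K w" arbitrary: w C rule: less_induct)
  case less
  let ?c = "core G K w" and ?h = "height K w"
  have w: "w \<in> worlds K" by fact
  have above: "\<exists>\<Gamma>. drv G (height K v) (Reg \<Gamma> C) \<and> core G K v \<subseteq> Cl \<Gamma>"
    if "v \<in> above K w" "C \<in> Sr G" "\<not> forces K v C" for v C
    using less.hyps[of v C] height_above[OF K w that(1)] that by (auto simp: above_def)
  have irr: "\<exists>\<Sigma> \<Theta>. drv G ?h (Irr \<Sigma> \<Theta> C) \<and> \<Sigma> \<subseteq> ?c \<and> ?c \<subseteq> \<Sigma> \<union> \<Theta>"
    if "C \<in> Sr G" "\<not> forces K w C" for C
    using irregular_complete[OF K w] above that by blast
  \<comment> \<open>All these antecedents are refuted at \<open>w\<close>, so each has an irregular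
    sequent; using them as premises lets a join retain the implications of the core.\<close>
  define U where "U = {Y. \<exists>Z. Imp Y Z \<in> ?c}"
  have "U \<subseteq> subfs G"
    by (auto simp: U_def core_def dest!: Sl_subfs subfs_closed(3))
  then have U: "finite U" by (rule finite_subset) simp
  have U_irr: "\<exists>\<Sigma> \<Theta>. drv G ?h (Irr \<Sigma> \<Theta> Y) \<and> \<Sigma> \<subseteq> ?c \<and> ?c \<subseteq> \<Sigma> \<union> \<Theta>" if "Y \<in> U" for Y
    using that by (intro irr) (auto simp: U_def core_def Vars_def intro: Sl_imp2)
  have U_Sl: "\<exists>Z. Imp Y Z \<in> Sl G" if "Y \<in> U" for Y
    using that by (auto simp: U_def core_def)
  have U_imp: "\<forall>Y Z. Imp Y Z \<in> ?c \<longrightarrow> Y \<in> U" by (auto simp: U_def)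
  have cVI: "?c \<subseteq> Vars \<union> Imps" using core_GBar[of G K w] by (auto simp: GBar_cases)
  have atom: "\<exists>\<Gamma>. drv G ?h (Reg \<Gamma> F) \<and> ?c \<subseteq> Cl \<Gamma>"
    if F: "F \<in> VarsBot" "F \<in> Sr G" "\<not> forces K w F" for F
  proof (cases "U = {}")
    \<comment> \<open>A join needs at least one premise. With no implication in the core the regular
      axiom already contains the core.\<close>
    case True
    then have "?c \<subseteq> GAt G"
      using cVI core_GBar[of G K w] by (auto simp: U_def GAt_def GBar_cases Imps_def)
    then have "?c \<subseteq> Cl (GAt G - {F})" using F(3) by (intro subset_ClI) (auto simp: core_forces)
    moreover have "drv G ?h (Reg (GAt G - {F}) F)"
      using F by (intro drv_axiom ax_reg) (auto simp: is_sequent_def GBar_def)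
    ultimately show ?thesis by blast
  next
    case False
    obtain n \<Sigma> \<Theta> A where j: "Ups n A = U" "join_cond n \<Sigma> \<Theta> A"
      "\<And>j. j < n \<Longrightarrow> drv G ?h (Irr (\<Sigma> j) (\<Theta> j) (A j))"
      "SigAt n \<Sigma> \<subseteq> ?c" "?c \<subseteq> SigAt n \<Sigma> \<union> ThAt n \<Theta> \<union> SigImp n \<Sigma> \<union> ThImp n \<Theta> A"
      "SigAt n \<Sigma> \<union> ThAt n \<Theta> \<union> SigImp n \<Sigma> \<union> ThImp n \<Theta> A \<subseteq> GBar G"
      using join_ex[OF U False _ U_imp cVI] U_irr by metis
    let ?G = "SigAt n \<Sigma> \<union> (ThAt n \<Theta> - {F}) \<union> SigImp n \<Sigma> \<union> ThImp n \<Theta> A"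
    have Fc: "F \<notin> ?c" using F(3) by (auto simp: core_forces)
    have "drv G ?h (Reg ?G F)"
    proof (rule drv_join[OF join_at])
      show "F \<in> VarsBot - SigAt n \<Sigma>" using F(1) Fc j(4) by blast
      show "\<forall>Y\<in>Ups n A. \<exists>Z. Imp Y Z \<in> Sl G" using U_Sl j(1) by blast
      show "is_sequent G (Reg ?G F)" using j(6) F(2) by (auto simp: is_sequent_def)
    qed (use j in auto)
    moreover have "?c \<subseteq> Cl ?G" using j(5) Fc by (intro subset_ClI) blast
    ultimately show ?thesis by blast
  qed
  from less.prems(2,3) show ?case
  proof (induction C rule: form.induct)
    case (Var p)
    then show ?case by (intro atom) (auto simp: VarsBot_def Vars_def)
  next
    case Bot
    then show ?case by (intro atom) (auto simp: VarsBot_def)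
  next
    case (And A B)
    then obtain C \<Gamma> where C: "C \<in> {A, B}" and 1: "drv G ?h (Reg \<Gamma> C)" "?c \<subseteq> Cl \<Gamma>"
      using Sr_and1 Sr_and2 by (metis forces.simps(3) insertCI)
    have "drv G ?h (Reg \<Gamma> (And A B))"
      using 1(1) drv_is_sequent[OF 1(1)] And.prems
      by (intro drv_logical[OF and_reg[OF C]]) (auto simp: is_sequent_def)
    then show ?case using 1 by blast
  next
    case (Or A B)
    \<comment> \<open>\<open>join_or\<close> requires both disjuncts among its premises; they are
      refuted at \<open>w\<close> itself, so the bound \<open>?h\<close> is kept.\<close>
    define V where "V = insert A (insert B U)"
    have V: "finite V" "V \<noteq> {}" using U by (auto simp: V_def)
    have V_irr: "\<forall>Y\<in>V. \<exists>\<Sigma> \<Theta>. drv G ?h (Irr \<Sigma> \<Theta> Y) \<and> \<Sigma> \<subseteq> ?c \<and> ?c \<subseteq> \<Sigma> \<union> \<Theta>"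
      using Or.prems(2) U_irr irr[OF Sr_or1[OF Or.prems(1)]] irr[OF Sr_or2[OF Or.prems(1)]]
      by (simp add: V_def)
    have V_imp: "\<forall>Y Z. Imp Y Z \<in> ?c \<longrightarrow> Y \<in> V" using U_imp by (auto simp: V_def)
    obtain n \<Sigma> \<Theta> A' where j: "Ups n A' = V" "join_cond n \<Sigma> \<Theta> A'"
      "\<And>j. j < n \<Longrightarrow> drv G ?h (Irr (\<Sigma> j) (\<Theta> j) (A' j))"
      "?c \<subseteq> SigAt n \<Sigma> \<union> ThAt n \<Theta> \<union> SigImp n \<Sigma> \<union> ThImp n \<Theta> A'"
      "SigAt n \<Sigma> \<union> ThAt n \<Theta> \<union> SigImp n \<Sigma> \<union> ThImp n \<Theta> A' \<subseteq> GBar G"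
      using join_ex[OF V V_irr V_imp cVI] by metis
    let ?G = "SigAt n \<Sigma> \<union> ThAt n \<Theta> \<union> SigImp n \<Sigma> \<union> ThImp n \<Theta> A'"
    have "drv G ?h (Reg ?G (Or A B))"
    proof (rule drv_join[OF join_or])
      show "{A, B} \<subseteq> Ups n A'" unfolding j(1) V_def by blast
      show "\<forall>Y\<in>Ups n A'. \<exists>Z. Imp Y Z \<in> Sl G \<or> Or Y Z \<in> Sr G \<or> Or Z Y \<in> Sr G"
        unfolding j(1) V_def using U_Sl Or.prems(1) by blast
      show "is_sequent G (Reg ?G (Or A B))" using j(5) Or.prems by (auto simp: is_sequent_def)
    qed (use j in auto)
    with subset_ClI[OF j(4)] show ?case by blast
  next
    case (Imp A B)
    have sr: "A \<in> Sl G" "B \<in> Sr G" using Imp.prems Sr_imp1 Sr_imp2 by blast+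
    have "\<exists>\<Gamma>. drv G ?h (Reg \<Gamma> B) \<and> ?c \<subseteq> Cl \<Gamma> \<and> A \<in> Cl \<Gamma>"
    proof (cases "forces K w A \<and> \<not> forces K w B")
      case True
      then obtain \<Gamma> where 1: "drv G ?h (Reg \<Gamma> B)" "?c \<subseteq> Cl \<Gamma>"
        using Imp.IH sr by blast
      moreover have "A \<in> Cl ?c" using forced_in_Cl_core[OF K w sr(1)] True by blast
      ultimately show ?thesis using Cl_least[of ?c \<Gamma>] by blast
    next
      case False
      from Imp_not_forced[OF K w Imp.prems(2) this]
      obtain v where v: "v \<in> above K w" "forces K v A" "\<not> forces K v B" "\<not> forces K w A" .
      then have vw: "v \<in> worlds K" "le K w v" by (auto simp: above_def)
      from above[OF v(1) sr(2) v(3)]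
      obtain \<Gamma> where G: "drv G (height K v) (Reg \<Gamma> B)" "core G K v \<subseteq> Cl \<Gamma>" by blast
      then have Cl: "Cl (core G K v) \<subseteq> Cl \<Gamma>" by (intro Cl_least)
      have "A \<in> Cl \<Gamma>" using forced_in_Cl_core[OF K vw(1) sr(1) v(2)] Cl by blast
      moreover have "?c \<subseteq> Cl \<Gamma>" using core_subset_Cl_above[OF K w vw, of G] Cl by blast
      \<comment> \<open>The sequent of \<open>v\<close> is reused at \<open>w\<close> without a
        jump.\<close>
      moreover have "drv G ?h (Reg \<Gamma> B)"
        using drv_mono[OF G(1)] height_above[OF K w v(1)] by simp
      ultimately show ?thesis by blast
    qed
    then obtain \<Gamma> where 1: "drv G ?h (Reg \<Gamma> B)" "?c \<subseteq> Cl \<Gamma>" "A \<in> Cl \<Gamma>" by blast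
    have "drv G ?h (Reg \<Gamma> (Imp A B))"
      using 1(1) drv_is_sequent[OF 1(1)] Imp.prems
      by (intro drv_logical[OF imp_in_reg[OF 1(3)]]) (auto simp: is_sequent_def)
    then show ?case using 1 by blast
  qed
qed

subsection \<open>Premises and conclusions\<close>

text \<open>Every rule application strictly decreases this rank in the lexicographic order:
  \<open>\<supset>\<^sub>\<notin>\<close> decreases the first component because it loses \<open>A\<close> from the closure, and
  the join rules are the only ones that lead from irregular to regular sequents.\<close>

definition rank :: "form \<Rightarrow> sequent \<Rightarrow> nat \<times> nat \<times> nat" where
  "rank G \<sigma> = (card (GBar G - Cl (Lhs \<sigma>)), of_bool (regular \<sigma>), size (Rhs \<sigma>))"

abbreviation lex3 :: "((nat \<times> nat \<times> nat) \<times> (nat \<times> nat \<times> nat)) set" where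
  "lex3 \<equiv> less_than <*lex*> less_than <*lex*> less_than"

lemma join_bounds:
  assumes "join_cond n \<Sigma> \<Theta> A" "j < n"
  shows "SigAt n \<Sigma> \<union> ThAt n \<Theta> \<union> SigImp n \<Sigma> \<union> ThImp n \<Theta> A \<subseteq> \<Sigma> j \<union> \<Theta> j"
proof -
  have "\<Sigma> i \<subseteq> \<Sigma> j \<union> \<Theta> j" if "i < n" for i
    using assms that by (cases "i = j") (auto simp: join_cond_def)
  then have "SigAt n \<Sigma> \<subseteq> \<Sigma> j \<union> \<Theta> j" "SigImp n \<Sigma> \<subseteq> \<Sigma> j \<union> \<Theta> j"
    unfolding SigAt_def SigImp_def by blast+
  moreover have "ThAt n \<Theta> \<subseteq> \<Theta> j" "ThImp n \<Theta> A \<subseteq> \<Theta> j"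
    using assms(2) unfolding ThAt_def ThImp_def by blast+
  ultimately show ?thesis by blast
qed

text \<open>Lets the forcing argument treat both join rules alike. For \<open>join_at\<close>,
  \<open>F\<close> avoids \<open>SigAt\<close> by the side condition, is removed from
  \<open>ThAt\<close>, and is no implication.\<close>

lemma join_properties:
  assumes j: "join_schema G \<pi> \<sigma>" and s: "\<forall>\<tau>\<in>set \<pi>. is_sequent G \<tau>"
  shows join_premise: "\<tau> \<in> set \<pi> \<Longrightarrow>
      \<exists>\<Sigma> \<Theta>. \<tau> = Irr \<Sigma> \<Theta> (Rhs \<tau>) \<and> \<Sigma> \<subseteq> Lhs \<sigma> \<and> Lhs \<sigma> \<subseteq> \<Sigma> \<union> \<Theta>"
    and join_Imp: "Imp Y Z \<in> Lhs \<sigma> \<Longrightarrow> \<exists>\<tau>\<in>set \<pi>. Rhs \<tau> = Y"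
    and join_Rhs: "Rhs \<sigma> \<in> VarsBot - Lhs \<sigma> \<or>
      (\<exists>\<tau>1\<in>set \<pi>. \<exists>\<tau>2\<in>set \<pi>. Rhs \<sigma> = Or (Rhs \<tau>1) (Rhs \<tau>2))"
proof -
  obtain n \<Sigma> \<Theta> A where c: "join_cond n \<Sigma> \<Theta> A" and \<pi>: "\<pi> = join_prems n \<Sigma> \<Theta> A"
    and lo: "SigAt n \<Sigma> \<union> SigImp n \<Sigma> \<subseteq> Lhs \<sigma>"
    and up: "Lhs \<sigma> \<subseteq> SigAt n \<Sigma> \<union> ThAt n \<Theta> \<union> SigImp n \<Sigma> \<union> ThImp n \<Theta> A"
    and R: "Rhs \<sigma> \<in> VarsBot - Lhs \<sigma> \<or> (\<exists>Y\<in>Ups n A. \<exists>Z\<in>Ups n A. Rhs \<sigma> = Or Y Z)"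
    using j
  proof cases
    case (join_at n \<Sigma> \<Theta> A F)
    have "F \<notin> SigImp n \<Sigma>" "F \<notin> ThImp n \<Theta> A"
      using join_at(4) by (auto simp: SigImp_def ThImp_def VarsBot_def Vars_def Imps_def)
    then have "Rhs \<sigma> \<in> VarsBot - Lhs \<sigma>" using join_at(2,4) by simp
    then show thesis using that[OF join_at(3,1)] join_at(2) by auto
  next
    case (join_or n \<Sigma> \<Theta> A C1 C2)
    then show thesis using that[OF join_or(3,1)] by auto
  qed
  have set_\<pi>: "set \<pi> = (\<lambda>j. Irr (\<Sigma> j) (\<Theta> j) (A j)) ` {..<n}"
    by (auto simp: \<pi> join_prems_def)
  have Ups: "\<exists>\<tau>\<in>set \<pi>. Rhs \<tau> = Y" if "Y \<in> Ups n A" for Y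
    using that by (auto simp: Ups_def set_\<pi>)
  show "\<exists>\<Sigma> \<Theta>. \<tau> = Irr \<Sigma> \<Theta> (Rhs \<tau>) \<and> \<Sigma> \<subseteq> Lhs \<sigma> \<and> Lhs \<sigma> \<subseteq> \<Sigma> \<union> \<Theta>" if \<tau>: "\<tau> \<in> set \<pi>"
  proof -
    obtain i where i: "i < n" "\<tau> = Irr (\<Sigma> i) (\<Theta> i) (A i)" using \<tau> by (auto simp: set_\<pi>)
    have "is_sequent G \<tau>" using s \<tau> by blast
    then have "\<Sigma> i \<subseteq> Vars \<union> Imps" using i(2) by (auto simp: is_sequent_def GBar_cases)
    then have "\<Sigma> i \<subseteq> SigAt n \<Sigma> \<union> SigImp n \<Sigma>"
      using i(1) unfolding SigAt_def SigImp_def by blast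
    then have "\<Sigma> i \<subseteq> Lhs \<sigma>" using lo by blast
    moreover have "Lhs \<sigma> \<subseteq> \<Sigma> i \<union> \<Theta> i" using up join_bounds[OF c i(1)] by blast
    ultimately show ?thesis using i(2) by auto
  qed
  show "\<exists>\<tau>\<in>set \<pi>. Rhs \<tau> = Y" if "Imp Y Z \<in> Lhs \<sigma>"
  proof (rule Ups)
    have "0 < n" using c by (simp add: join_cond_def)
    then have "SigAt n \<Sigma> \<union> ThAt n \<Theta> \<subseteq> Vars" unfolding SigAt_def ThAt_def by blast
    moreover have "Imp Y Z \<notin> Vars" by (auto simp: Vars_def)
    ultimately have "Imp Y Z \<in> SigImp n \<Sigma> \<union> ThImp n \<Theta> A" using that up by blast
    then show "Y \<in> Ups n A" using c by (auto simp: join_cond_def ThImp_def)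
  qed
  show "Rhs \<sigma> \<in> VarsBot - Lhs \<sigma> \<or>
      (\<exists>\<tau>1\<in>set \<pi>. \<exists>\<tau>2\<in>set \<pi>. Rhs \<sigma> = Or (Rhs \<tau>1) (Rhs \<tau>2))"
    using R
  proof
    assume "\<exists>Y\<in>Ups n A. \<exists>Z\<in>Ups n A. Rhs \<sigma> = Or Y Z"
    then obtain Y Z where YZ: "Y \<in> Ups n A" "Z \<in> Ups n A" "Rhs \<sigma> = Or Y Z" by blast
    from Ups[OF YZ(1)] Ups[OF YZ(2)] YZ(3) show ?thesis by auto
  qed simp
qed

text \<open>Since \<open>Cl X\<close> contains no variables beyond those of \<open>X\<close>, this
  makes the valuation of the extracted model monotone.\<close>

lemma Lhs_premise:
  assumes r: "rule_inst G \<pi> \<sigma>" and \<tau>: "\<tau> \<in> set \<pi>"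
  shows "Lhs \<sigma> \<subseteq> Cl (Lhs \<tau>)"
proof -
  consider "logical_schema G \<pi> \<sigma>" | "join_schema G \<pi> \<sigma>"
    using assms by (auto simp: rule_inst_def)
  then show ?thesis
  proof cases
    case 1
    then show ?thesis
    proof cases
      case or_irr
      then have "Lhs \<sigma> \<subseteq> Lhs \<tau>" using \<tau> by auto
      then show ?thesis by (rule subset_ClI)
    qed (use \<tau> in \<open>auto intro: Cl_base\<close>)
  next
    case 2
    have "\<forall>\<tau>\<in>set \<pi>. is_sequent G \<tau>" using r by (simp add: rule_inst_def)
    from join_premise[OF 2 this \<tau>] obtain \<Sigma> \<Theta>
      where "\<tau> = Irr \<Sigma> \<Theta> (Rhs \<tau>)" "Lhs \<sigma> \<subseteq> \<Sigma> \<union> \<Theta>" by blast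
    then have "Lhs \<sigma> \<subseteq> Lhs \<tau>" by (metis Lhs.simps(2))
    then show ?thesis by (rule subset_ClI)
  qed
qed

lemma join_premise_irregular: "join_schema G \<pi> \<sigma> \<Longrightarrow> \<tau> \<in> set \<pi> \<Longrightarrow> \<not> regular \<tau>"
  by (erule join_schema.cases) (auto simp: join_prems_def)

lemma join_conclusion_regular: "join_schema G \<pi> \<sigma> \<Longrightarrow> regular \<sigma>"
  by (erule join_schema.cases) auto

lemma logical_premise_size:
  assumes "logical_schema G \<pi> \<sigma>" "\<tau> \<in> set \<pi>"
  shows "size (Rhs \<tau>) < size (Rhs \<sigma>)"
  using assms by cases auto

lemma logical_premise_kind:
  assumes "logical_schema G \<pi> \<sigma>" "\<tau> \<in> set \<pi>" "regular \<tau> \<noteq> regular \<sigma>"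
  obtains \<Gamma> B \<Theta> A where "\<tau> = Reg \<Gamma> B" "\<sigma> = Irr {} \<Theta> (Imp A B)" "A \<in> Cl \<Gamma> - Cl \<Theta>"
  using assms by cases auto

lemma rank_premise:
  assumes r: "rule_inst G \<pi> \<sigma>" "\<tau> \<in> set \<pi>"
  shows "(rank G \<tau>, rank G \<sigma>) \<in> lex3"
proof -
  have "Cl (Lhs \<sigma>) \<subseteq> Cl (Lhs \<tau>)" using Lhs_premise[OF r] by (rule Cl_least)
  then have sub: "GBar G - Cl (Lhs \<tau>) \<subseteq> GBar G - Cl (Lhs \<sigma>)" by blast
  have fin: "finite (GBar G - Cl (Lhs \<sigma>))" using finite_GBar by simp
  have le: "card (GBar G - Cl (Lhs \<tau>)) \<le> card (GBar G - Cl (Lhs \<sigma>))"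
    using card_mono[OF fin sub] .
  consider "logical_schema G \<pi> \<sigma>" | "join_schema G \<pi> \<sigma>"
    using r by (auto simp: rule_inst_def)
  then show ?thesis
  proof cases
    case 1
    show ?thesis
    proof (cases "regular \<tau> = regular \<sigma>")
      case True
      then show ?thesis
        using le logical_premise_size[OF 1 r(2)] by (auto simp: rank_def)
    next
      case False
      with 1 r(2) obtain \<Gamma> B \<Theta> A where
        *: "\<tau> = Reg \<Gamma> B" "\<sigma> = Irr {} \<Theta> (Imp A B)" "A \<in> Cl \<Gamma> - Cl \<Theta>"
        by (rule logical_premise_kind)
      have "is_sequent G \<tau>" using r by (auto simp: rule_inst_def)
      then have "\<Gamma> \<subseteq> GBar G" using *(1) by (simp add: is_sequent_def)
      \<comment> \<open>\<open>A\<close> itself need not lie in \<open>GBar G\<close>, but some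
        member of \<open>\<Gamma>\<close> must be missing from \<open>Cl \<Theta>\<close>, as
        otherwise \<open>Cl \<Gamma> \<subseteq> Cl \<Theta>\<close>.\<close>
      then have "GBar G - Cl \<Gamma> \<noteq> GBar G - Cl \<Theta>"
        using *(3) Cl_least[of \<Gamma> \<Theta>] Cl_extensive[of \<Gamma>] by blast
      then have "card (GBar G - Cl (Lhs \<tau>)) < card (GBar G - Cl (Lhs \<sigma>))"
        using sub * by (intro psubset_card_mono[OF fin]) auto
      then show ?thesis by (simp add: rank_def)
    qed
  next
    case 2
    then show ?thesis
      using le join_premise_irregular[OF 2 r(2)] join_conclusion_regular[OF 2]
      by (auto simp: rank_def)
  qed
qed

section \<open>Nodes and paths of a derivation tree\<close>

lemma nodes_refl: "D \<in> nodes D"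
  by (cases D) auto

lemma nodes_trans: "E \<in> nodes D \<Longrightarrow> nodes E \<subseteq> nodes D"
  by (induction D) auto

lemma finite_nodes: "finite (nodes D)"
  by (induction D) auto

lemma is_deriv_nodes: "is_deriv G D \<Longrightarrow> E \<in> nodes D \<Longrightarrow> is_deriv G E"
proof (induction rule: is_deriv.induct)
  case (1 Ds \<sigma>)
  then show ?case by (auto intro!: is_deriv.intros)
qed

lemma is_deriv_rule: "is_deriv G D \<Longrightarrow> Der Ds \<sigma> \<in> nodes D \<Longrightarrow> rule_inst G (map concl Ds) \<sigma>"
  by (drule (1) is_deriv_nodes) (auto elim: is_deriv.cases)

lemma step_mono:
  assumes "E \<in> nodes D" "(step E)\<^sup>*\<^sup>* \<sigma> \<tau>"
  shows "(step D)\<^sup>*\<^sup>* \<sigma> \<tau>"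
proof -
  have "step E \<le> step D" using nodes_trans[OF assms(1)] unfolding step_def by blast
  then show ?thesis using assms(2) rtranclp_mono by blast
qed

lemma step_concl: "E \<in> nodes D \<Longrightarrow> (step D)\<^sup>*\<^sup>* (concl E) (concl D)"
proof (induction D)
  case (Der Ds \<sigma>)
  show ?case
  proof (cases "E = Der Ds \<sigma>")
    case False
    then obtain D' where D': "D' \<in> set Ds" "E \<in> nodes D'" using Der.prems by auto
    have "D' \<in> nodes (Der Ds \<sigma>)" using D'(1) nodes_refl[of D'] by auto
    then have "(step (Der Ds \<sigma>))\<^sup>*\<^sup>* (concl E) (concl D')"
      using Der.IH[OF D'] by (rule step_mono)
    moreover have "step (Der Ds \<sigma>) (concl D') \<sigma>"
      unfolding step_def using D'(1) by (intro exI[of _ Ds]) auto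
    ultimately show ?thesis by simp
  qed simp
qed

lemma step_rule:
  assumes "is_deriv G D" "step D \<tau> \<sigma>"
  obtains \<pi> where "rule_inst G \<pi> \<sigma>" "\<tau> \<in> set \<pi>"
  using assms is_deriv_rule unfolding step_def by metis

lemma steps_Lhs:
  assumes "is_deriv G D" "(step D)\<^sup>*\<^sup>* \<tau> \<sigma>"
  shows "Lhs \<sigma> \<subseteq> Cl (Lhs \<tau>)"
  using assms(2)
proof induction
  case base
  show ?case by (rule Cl_extensive)
next
  case (step \<sigma> \<sigma>')
  from assms(1) step.hyps(2) obtain \<pi> where "rule_inst G \<pi> \<sigma>'" "\<sigma> \<in> set \<pi>"
    by (rule step_rule)
  then have "Lhs \<sigma>' \<subseteq> Cl (Lhs \<sigma>)" by (rule Lhs_premise)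
  also have "\<dots> \<subseteq> Cl (Lhs \<tau>)" using step.IH by (rule Cl_least)
  finally show ?case .
qed

lemma steps_rank:
  assumes "is_deriv G D" "(step D)\<^sup>+\<^sup>+ \<tau> \<sigma>"
  shows "(rank G \<tau>, rank G \<sigma>) \<in> lex3"
  using assms(2)
proof induction
  case (base \<sigma>)
  with assms(1) show ?case by (metis step_rule rank_premise)
next
  case (step \<sigma> \<sigma>')
  then have "(rank G \<sigma>, rank G \<sigma>') \<in> lex3" using assms(1) by (metis step_rule rank_premise)
  moreover have "trans lex3" by (intro trans_lex_prod trans_less_than)
  ultimately show ?case using step.IH by (meson transD)
qed

text \<open>Paths may switch between occurrences of a sequent, so well-foundedness of the tree alone
  does not exclude cycles; the rank does.\<close>

lemma steps_antisym:
  assumes "is_deriv G D" "(step D)\<^sup>*\<^sup>* \<tau> \<sigma>" "(step D)\<^sup>*\<^sup>* \<sigma> \<tau>"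
  shows "\<tau> = \<sigma>"
proof (rule ccontr)
  assume "\<tau> \<noteq> \<sigma>"
  then have "(step D)\<^sup>+\<^sup>+ \<tau> \<tau>" using assms(2,3) by (metis rtranclpD tranclp_rtranclp_tranclp)
  then have "(rank G \<tau>, rank G \<tau>) \<in> lex3" by (rule steps_rank[OF assms(1)])
  then show False by (simp add: rank_def)
qed

subsection \<open>The extracted model\<close>

lemma p_sequents_nodes: "E \<in> nodes D \<Longrightarrow> p_sequents G E \<subseteq> p_sequents G D"
  using nodes_trans[of E D] by (auto simp: p_sequents_def)

lemma finite_p_sequents: "finite (p_sequents G D)"
proof (rule finite_subset)
  show "p_sequents G D \<subseteq> concl ` nodes D" by (force simp: p_sequents_def)
qed (simp add: finite_nodes)

text \<open>A regular sequent that is not a p-sequent is inferred from a single regular premise with the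
  same left-hand side, so one arrives at a p-sequent \<open>\<rho>\<close>, which bounds all others. Semantically,
  refuting \<open>Rhs \<rho>\<close> entails refuting the right formula at the end of that branch.\<close>

lemma regular_p_sequent:
  assumes "is_deriv G D" "regular (concl D)"
  shows "\<exists>\<rho>\<in>p_sequents G D. Lhs \<rho> = Lhs (concl D) \<and> (step D)\<^sup>*\<^sup>* \<rho> (concl D) \<and>
    (\<forall>\<sigma>\<in>p_sequents G D. (step D)\<^sup>*\<^sup>* \<sigma> \<rho>) \<and>
    (\<forall>(K :: sequent kripke) w. kripke_model K \<longrightarrow> w \<in> worlds K \<longrightarrow>
      (\<forall>X\<in>Cl (Lhs \<rho>). forces K w X) \<longrightarrow> \<not> forces K w (Rhs \<rho>) \<longrightarrow>
      \<not> forces K w (Rhs (concl D)))"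
  using assms
proof (induction rule: is_deriv.induct)
  case (1 Ds \<sigma>)
  let ?D = "Der Ds \<sigma>"
  have rule: "rule_inst G (map concl Ds) \<sigma>" by fact
  show ?case
  proof (cases "Ds = [] \<and> ax_schema G \<sigma> \<or> join_schema G (map concl Ds) \<sigma>")
    case True
    then have "\<sigma> \<in> p_sequents G ?D" using "1.prems" by (auto simp: p_sequents_def)
    moreover have "(step ?D)\<^sup>*\<^sup>* \<tau> \<sigma>" if "\<tau> \<in> p_sequents G ?D" for \<tau>
    proof -
      obtain Ds' where "Der Ds' \<tau> \<in> nodes ?D" using \<open>\<tau> \<in> _\<close> by (auto simp: p_sequents_def)
      from step_concl[OF this] show ?thesis by simp
    qed
    ultimately show ?thesis by (intro bexI[of _ \<sigma>]) simp_all
  next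
    case False
    then have l: "logical_schema G (map concl Ds) \<sigma>" using rule by (auto simp: rule_inst_def)
    then obtain D' where D': "Ds = [D']" "regular (concl D')" "Lhs \<sigma> = Lhs (concl D')"
      and F: "\<And>(K :: sequent kripke) w. kripke_model K \<Longrightarrow> w \<in> worlds K \<Longrightarrow>
        \<forall>X\<in>Cl (Lhs \<sigma>). forces K w X \<Longrightarrow>
        \<not> forces K w (Rhs (concl D')) \<Longrightarrow> \<not> forces K w (Rhs \<sigma>)"
    proof cases
      case (and_reg A A1 A2 \<Gamma>)
      then show thesis by (intro that[of "hd Ds"]) auto
    next
      case (imp_in_reg A \<Gamma> B)
      then show thesis by (intro that[of "hd Ds"]) (auto dest: le_refl)
    qed (use "1.prems" in auto)
    have D'n: "D' \<in> nodes ?D" using D'(1) nodes_refl by simp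
    obtain \<rho> where \<rho>: "\<rho> \<in> p_sequents G D'" "Lhs \<rho> = Lhs (concl D')"
      "(step D')\<^sup>*\<^sup>* \<rho> (concl D')" "\<forall>\<sigma>\<in>p_sequents G D'. (step D')\<^sup>*\<^sup>* \<sigma> \<rho>"
      and F': "\<forall>(K :: sequent kripke) w. kripke_model K \<longrightarrow> w \<in> worlds K \<longrightarrow>
        (\<forall>X\<in>Cl (Lhs \<rho>). forces K w X) \<longrightarrow> \<not> forces K w (Rhs \<rho>) \<longrightarrow>
        \<not> forces K w (Rhs (concl D'))"
      using "1.IH" D' by auto
    have p: "p_sequents G ?D = p_sequents G D'"
    proof
      show "p_sequents G ?D \<subseteq> p_sequents G D'"
        using False D'(1) by (auto simp: p_sequents_def)
    qed (rule p_sequents_nodes[OF D'n])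
    show ?thesis
    proof (intro bexI conjI ballI allI impI)
      show "\<rho> \<in> p_sequents G ?D" using \<rho> p by simp
      show "Lhs \<rho> = Lhs (concl ?D)" using \<rho> D' by simp
      have "step ?D (concl D') \<sigma>" unfolding step_def using D'(1) by (intro exI[of _ Ds]) simp
      then show "(step ?D)\<^sup>*\<^sup>* \<rho> (concl ?D)"
        using step_mono[OF D'n \<rho>(3)] by simp
      show "(step ?D)\<^sup>*\<^sup>* \<tau> \<rho>" if "\<tau> \<in> p_sequents G ?D" for \<tau>
        using step_mono[OF D'n] \<rho>(4) that p by simp
      show "\<not> forces K w (Rhs (concl ?D))"
        if "kripke_model K" "w \<in> worlds K" "\<forall>X\<in>Cl (Lhs \<rho>). forces K w X"
          "\<not> forces K w (Rhs \<rho>)" for K :: "sequent kripke" and w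
        using F[OF that(1,2)] F' that \<rho>(2) D'(3) by simp
    qed
  qed
qed

lemma Mod_root:
  assumes D: "is_deriv G D" and \<rho>: "\<rho> \<in> p_sequents G D" "\<forall>\<sigma>\<in>p_sequents G D. (step D)\<^sup>*\<^sup>* \<sigma> \<rho>"
  shows "root (Mod G D) = \<rho>"
proof -
  have "(THE \<rho>. \<rho> \<in> p_sequents G D \<and> (\<forall>\<sigma>\<in>p_sequents G D. p_le D \<rho> \<sigma>)) = \<rho>"
    using \<rho> by (intro the_equality) (auto simp: p_le_def intro: steps_antisym[OF D])
  then show ?thesis by (simp add: Mod_def)
qed

lemma kripke_model_Mod:
  assumes D: "is_deriv G D" "regular (concl D)"
  shows "kripke_model (Mod G D)"
proof -
  obtain \<rho> where \<rho>: "\<rho> \<in> p_sequents G D" "\<forall>\<sigma>\<in>p_sequents G D. (step D)\<^sup>*\<^sup>* \<sigma> \<rho>"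
    using regular_p_sequent[OF D] by auto
  note root = Mod_root[OF D(1) \<rho>]
  have [simp]: "worlds (Mod G D) = p_sequents G D" "le (Mod G D) = p_le D"
    "val (Mod G D) = (\<lambda>\<sigma>. {p. Var p \<in> Lhs \<sigma>})"
    by (simp_all add: Mod_def)
  show ?thesis
    unfolding kripke_model_def
  proof (intro conjI ballI impI)
    show "reflp_on (worlds (Mod G D)) (le (Mod G D))"
      by (auto simp: p_le_def intro: reflp_onI)
    show "antisymp_on (worlds (Mod G D)) (le (Mod G D))"
      by (auto simp: p_le_def intro!: antisymp_onI intro: steps_antisym[OF D(1)])
    show "transp_on (worlds (Mod G D)) (le (Mod G D))"
      by (auto simp: p_le_def intro!: transp_onI)
    show "val (Mod G D) v \<subseteq> val (Mod G D) w" if "le (Mod G D) v w" for v w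
      using steps_Lhs[OF D(1)] that by (fastforce simp: p_le_def)
  qed (use \<rho> root finite_p_sequents in \<open>auto simp: p_le_def\<close>)
qed

text \<open>The bounds on \<open>Lhs w\<close> in \<open>near\<close> express that no world lies between \<open>w\<close> and the irregular
  sequent \<open>\<tau>\<close>. The two claims about \<open>C\<close> in \<open>main\<close> depend on each other: a member \<open>Y \<supset> Z\<close> of
  \<open>Lhs w\<close> is forced because some premise refutes \<open>Y\<close>, while refuting an implication uses that
  members of the closure are forced.\<close>

lemma p_sequent_forces:
  assumes D: "is_deriv G D" "regular (concl D)" and w: "w \<in> p_sequents G D"
  shows "(\<forall>X\<in>Cl (Lhs w). forces (Mod G D) w X) \<and> \<not> forces (Mod G D) w (Rhs w)"
proof -
  have "wf (inv_image lex3 (rank G))" by (intro wf_inv_image wf_lex_prod wf_less_than)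
  then show ?thesis using w
  proof (induction w rule: wf_induct_rule)
    case (less w)
    let ?K = "Mod G D"
    have K: "kripke_model ?K" by (rule kripke_model_Mod[OF D])
    have [simp]: "worlds ?K = p_sequents G D" "le ?K = p_le D"
      "val ?K = (\<lambda>\<sigma>. {p. Var p \<in> Lhs \<sigma>})"
      by (simp_all add: Mod_def)
    have w: "w \<in> p_sequents G D" by fact
    have above: "(\<forall>X\<in>Cl (Lhs v). forces ?K v X) \<and> \<not> forces ?K v (Rhs v)"
      if "v \<in> p_sequents G D" "(step D)\<^sup>*\<^sup>* v w" "v \<noteq> w" for v
    proof (rule less.IH)
      have "(step D)\<^sup>+\<^sup>+ v w" using that(2,3) by (meson rtranclpD)
      then have "(rank G v, rank G w) \<in> lex3" by (rule steps_rank[OF D(1)])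
      then show "(v, w) \<in> inv_image lex3 (rank G)" by simp
    qed fact
    obtain Ds where node: "Der Ds w \<in> nodes D"
      and p: "Ds = [] \<and> ax_schema G w \<or> join_schema G (map concl Ds) w" and reg: "regular w"
      using w by (auto simp: p_sequents_def)
    have r: "rule_inst G (map concl Ds) w" using is_deriv_rule[OF D(1) node] .
    then have wG: "Lhs w \<subseteq> GBar G" and seq: "\<forall>\<tau>\<in>set (map concl Ds). is_sequent G \<tau>"
      by (auto simp: rule_inst_def is_sequent_def)
    define near where "near \<tau> \<longleftrightarrow> (\<exists>E\<in>nodes D. concl E = \<tau>) \<and> (step D)\<^sup>*\<^sup>* \<tau> w \<and>
      (\<exists>\<Sigma> \<Theta>. \<tau> = Irr \<Sigma> \<Theta> (Rhs \<tau>) \<and> \<Sigma> \<subseteq> Lhs w \<and> Lhs w \<subseteq> \<Sigma> \<union> \<Theta>)" for \<tau>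
    have prem_node: "(\<exists>E'\<in>nodes D. concl E' = \<tau>) \<and> (step D)\<^sup>*\<^sup>* \<tau> w"
      if *: "\<tau> \<in> set (map concl Es)" "Der Es \<sigma> \<in> nodes D" "(step D)\<^sup>*\<^sup>* \<sigma> w" for \<tau> Es \<sigma>
    proof
      obtain E where E: "E \<in> set Es" "concl E = \<tau>" using *(1) by auto
      have "E \<in> nodes (Der Es \<sigma>)" using E(1) nodes_refl[of E] by auto
      then show "\<exists>E'\<in>nodes D. concl E' = \<tau>" using nodes_trans[OF that(2)] E(2) by blast
      have "step D \<tau> \<sigma>" using that(1,2) unfolding step_def by blast
      then show "(step D)\<^sup>*\<^sup>* \<tau> w" using that(3) by (rule converse_rtranclp_into_rtranclp)
    qed
    have near_premise: "near \<tau>" if "\<tau> \<in> set (map concl Ds)" for \<tau>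
    proof -
      have "join_schema G (map concl Ds) w" using p that by auto
      from join_premise[OF this seq that] prem_node[OF that node] show ?thesis
        by (simp add: near_def)
    qed
    have near_Imp: "\<exists>\<tau>. near \<tau> \<and> Rhs \<tau> = Y" if "Imp Y Z \<in> Lhs w" for Y Z
      using p
    proof
      assume "Ds = [] \<and> ax_schema G w"
      then have "ax_schema G w" ..
      then have False using that reg by cases (auto simp: GAt_def Vars_def)
      then show ?thesis ..
    next
      assume "join_schema G (map concl Ds) w"
      from join_Imp[OF this seq that] near_premise show ?thesis by blast
    qed
    have main: "(C \<in> Cl (Lhs w) \<longrightarrow> forces ?K w C) \<and>
      (\<forall>\<tau>. near \<tau> \<longrightarrow> Rhs \<tau> = C \<longrightarrow> \<not> forces ?K w C)" for C
    proof (induction C rule: measure_induct_rule[of size])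
      case (less C)
      have Cl: "forces ?K w X" if "X \<in> Cl (Lhs w)" "size X < size C" for X
        using less that by blast
      have nf: "\<not> forces ?K w (Rhs \<tau>)" if "near \<tau>" "size (Rhs \<tau>) < size C" for \<tau>
        using less that by blast
      show ?case
      proof (intro conjI impI allI)
        assume "C \<in> Cl (Lhs w)"
        then show "forces ?K w C"
        proof cases
          case Cl_base
          then consider q where "C = Var q" | Y Z where "C = Imp Y Z"
            using wG by (auto simp: GBar_cases Vars_def Imps_def)
          then show ?thesis
          proof cases
            case 1
            then show ?thesis using Cl_base by simp
          next
            case 2
            obtain \<tau> where "near \<tau>" "Rhs \<tau> = Y" using near_Imp Cl_base 2 by blast
            then have wY: "\<not> forces ?K w Y" using nf[of \<tau>] 2 by simp
            \<comment> \<open>As \<open>Y\<close> is refuted at \<open>w\<close>, only worlds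
              strictly above \<open>w\<close> matter, and these are covered by the outer
              induction.\<close>
            have "forces ?K v Z" if v: "v \<in> p_sequents G D" "p_le D w v" "forces ?K v Y" for v
            proof -
              have "v \<noteq> w" using wY v(3) by blast
              moreover have vw: "(step D)\<^sup>*\<^sup>* v w" using v(2) by (simp add: p_le_def)
              moreover have "C \<in> Cl (Lhs v)" using steps_Lhs[OF D(1) vw] Cl_base by blast
              ultimately have "forces ?K v C" using above[OF v(1)] by blast
              then show ?thesis using 2 v le_refl[OF K, of v] by simp
            qed
            then show ?thesis using 2 by simp
          qed
        next
          case (Cl_imp B A)
          have "forces ?K w B" using Cl[of B] Cl_imp by simp
          then show ?thesis
            using forces_persistent[OF K, of w _ B] w Cl_imp(1) by simp
        qed (use Cl in auto)
      next
        fix \<tau> assume near: "near \<tau>" and C: "Rhs \<tau> = C"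
        then obtain Es \<Sigma> \<Theta> where node': "Der Es \<tau> \<in> nodes D" and \<tau>w: "(step D)\<^sup>*\<^sup>* \<tau> w"
          and \<tau>: "\<tau> = Irr \<Sigma> \<Theta> C" "\<Sigma> \<subseteq> Lhs w" "Lhs w \<subseteq> \<Sigma> \<union> \<Theta>"
          unfolding near_def by (metis deriv.collapse)
        have r': "rule_inst G (map concl Es) \<tau>" by (rule is_deriv_rule[OF D(1) node'])
        \<comment> \<open>From conclusion to irregular premise, \<open>\<Sigma>\<close> can only
          shrink and \<open>\<Sigma> \<union> \<Theta>\<close> only grow, so premises stay near the
          same \<open>w\<close>.\<close>
        have prem: "\<not> forces ?K w C'"
          if "Irr \<Sigma>' \<Theta>' C' \<in> set (map concl Es)" "\<Sigma>' \<subseteq> Lhs w" "Lhs w \<subseteq> \<Sigma>' \<union> \<Theta>'"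
            "size C' < size C" for \<Sigma>' \<Theta>' C'
          using nf[of "Irr \<Sigma>' \<Theta>' C'"] prem_node[OF that(1) node' \<tau>w] that(2-)
          by (simp add: near_def)
        have "\<not> join_schema G (map concl Es) \<tau>" using join_conclusion_regular \<tau>(1) by fastforce
        then consider "ax_schema G \<tau>" | "logical_schema G (map concl Es) \<tau>"
          using r' by (auto simp: rule_inst_def)
        then show "\<not> forces ?K w C"
        proof cases
          case 1
          then show ?thesis
            using \<tau> by cases (auto simp: VarsBot_def Vars_def GImp_def Imps_def)
        next
          case 2
          then show ?thesis
          proof cases
            case (and_irr A A1 A2 \<Sigma>' \<Theta>')
            then show ?thesis using prem[of \<Sigma> \<Theta> A] \<tau> by auto
          next
            case (or_irr \<Sigma>1 \<Sigma>2 \<Theta>2 \<Theta>1 C1 C2)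
            have "\<not> forces ?K w C1"
              by (rule prem[of \<Sigma>1 \<Theta>1]) (use or_irr \<tau> in auto)
            moreover have "\<not> forces ?K w C2"
              by (rule prem[of \<Sigma>2 \<Theta>2]) (use or_irr \<tau> in auto)
            ultimately show ?thesis using or_irr(2) \<tau>(1) by simp
          next
            case (imp_in_irr \<Theta>' \<Lambda> A \<Sigma>' B)
            have CI: "C = Imp A B" using imp_in_irr(2) \<tau>(1) by simp
            have "\<not> forces ?K w B"
              by (rule prem[of \<Sigma>' "\<Theta>' \<union> \<Lambda>"]) (use imp_in_irr \<tau> in auto)
            moreover have "\<Sigma>' \<union> \<Lambda> \<subseteq> Lhs w" using imp_in_irr(2) \<tau> by simp
            then have "A \<in> Cl (Lhs w)" using imp_in_irr(4) Cl_mono by blast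
            then have "forces ?K w A" using Cl CI by simp
            ultimately show ?thesis using CI le_refl[OF K, of w] w by auto
          next
            case (imp_notin \<Theta>' \<Gamma> A B)
            have CI: "C = Imp A B" and \<Theta>': "Lhs w \<subseteq> \<Theta>'" using imp_notin(2) \<tau> by simp_all
            have B: "Reg \<Gamma> B \<in> set (map concl Es)" using imp_notin(1) by simp
            from prem_node[OF B node' \<tau>w] obtain E where
              E: "E \<in> nodes D" "concl E = Reg \<Gamma> B" "(step D)\<^sup>*\<^sup>* (Reg \<Gamma> B) w" by blast
            \<comment> \<open>The premise \<open>Reg \<Gamma> B\<close> need not be a world, hence
              the passage to \<open>\<rho>\<close>. The lemma speaks of all models, so it applies to
              the subderivation \<open>E\<close> within the model of \<open>D\<close>.\<close>
            obtain \<rho> where \<rho>: "\<rho> \<in> p_sequents G E" "Lhs \<rho> = \<Gamma>" "(step E)\<^sup>*\<^sup>* \<rho> (Reg \<Gamma> B)"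
              and F: "\<forall>(K :: sequent kripke) w. kripke_model K \<longrightarrow> w \<in> worlds K \<longrightarrow>
                (\<forall>X\<in>Cl (Lhs \<rho>). forces K w X) \<longrightarrow> \<not> forces K w (Rhs \<rho>) \<longrightarrow> \<not> forces K w B"
              using regular_p_sequent[OF is_deriv_nodes[OF D(1) E(1)]] E(2) by auto
            have \<rho>D: "\<rho> \<in> p_sequents G D" using \<rho>(1) p_sequents_nodes[OF E(1)] by blast
            have \<rho>w: "(step D)\<^sup>*\<^sup>* \<rho> w" using step_mono[OF E(1) \<rho>(3)] E(3) by simp
            \<comment> \<open>Since \<open>Lhs w \<subseteq> \<Theta>'\<close>, the formula
              \<open>A\<close> separates \<open>\<rho>\<close> from \<open>w\<close>; so
              \<open>\<rho>\<close> is strictly above.\<close>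
            have "A \<in> Cl \<Gamma>" "A \<notin> Cl \<Theta>'" using imp_notin(4) by auto
            then have "\<rho> \<noteq> w" using \<rho>(2) Cl_mono[OF \<Theta>'] by blast
            from above[OF \<rho>D \<rho>w this]
            have \<rho>F: "\<forall>X\<in>Cl (Lhs \<rho>). forces ?K \<rho> X" "\<not> forces ?K \<rho> (Rhs \<rho>)" by simp_all
            have "\<not> forces ?K \<rho> B" using F K \<rho>D \<rho>F by simp
            moreover have "forces ?K \<rho> A" using \<rho>F(1) \<rho>(2) \<open>A \<in> Cl \<Gamma>\<close> by simp
            ultimately show ?thesis using CI \<rho>D \<rho>w by (auto simp: p_le_def)
          qed (use \<tau>(1) in auto)
        qed
      qed
    qed
    have "\<not> forces ?K w (Rhs w)"
    proof -
      have "Rhs w \<in> VarsBot - Lhs w \<or> (\<exists>\<tau>1\<in>set (map concl Ds). \<exists>\<tau>2\<in>set (map concl Ds).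
        Rhs w = Or (Rhs \<tau>1) (Rhs \<tau>2))"
        using p
      proof
        assume "Ds = [] \<and> ax_schema G w"
        then have "ax_schema G w" ..
        then show ?thesis using reg by cases auto
      next
        assume "join_schema G (map concl Ds) w"
        from join_Rhs[OF this seq] show ?thesis .
      qed
      then show ?thesis
      proof
        assume "Rhs w \<in> VarsBot - Lhs w"
        then show ?thesis by (auto simp: VarsBot_def Vars_def)
      next
        assume "\<exists>\<tau>1\<in>set (map concl Ds). \<exists>\<tau>2\<in>set (map concl Ds). Rhs w = Or (Rhs \<tau>1) (Rhs \<tau>2)"
        then obtain \<tau>1 \<tau>2 where "near \<tau>1" "near \<tau>2" and R: "Rhs w = Or (Rhs \<tau>1) (Rhs \<tau>2)"
          using near_premise by blast
        then have "\<not> forces ?K w (Rhs \<tau>1)" "\<not> forces ?K w (Rhs \<tau>2)" using main by blast+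
        then show ?thesis using R by simp
      qed
    qed
    then show ?case using main by blast
  qed
qed

lemma countermodel_Mod:
  assumes "is_deriv_of_goal G D"
  shows "countermodel (Mod G D) G"
proof -
  have D: "is_deriv G D" "regular (concl D)" and R: "Rhs (concl D) = G"
    using assms by (auto simp: is_deriv_of_goal_def)
  obtain \<rho> where \<rho>: "\<rho> \<in> p_sequents G D" "\<forall>\<sigma>\<in>p_sequents G D. (step D)\<^sup>*\<^sup>* \<sigma> \<rho>"
    and F: "\<forall>(K :: sequent kripke) w. kripke_model K \<longrightarrow> w \<in> worlds K \<longrightarrow>
      (\<forall>X\<in>Cl (Lhs \<rho>). forces K w X) \<longrightarrow> \<not> forces K w (Rhs \<rho>) \<longrightarrow> \<not> forces K w G"
    using regular_p_sequent[OF D] R by auto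
  have K: "kripke_model (Mod G D)" by (rule kripke_model_Mod[OF D])
  have "\<not> forces (Mod G D) \<rho> G"
    using F K \<rho>(1) p_sequent_forces[OF D \<rho>(1)] by (simp add: Mod_def)
  then show ?thesis using K Mod_root[OF D(1) \<rho>] by (simp add: countermodel_def)
qed

subsection \<open>Derivations of minimal nesting\<close>

definition depth :: "form \<Rightarrow> sequent \<Rightarrow> nat" where
  "depth G \<sigma> = (LEAST n. drv G n \<sigma>)"

definition derivable :: "form \<Rightarrow> sequent \<Rightarrow> bool" where
  "derivable G \<sigma> \<longleftrightarrow> (\<exists>n. drv G n \<sigma>)"

definition best :: "form \<Rightarrow> sequent \<Rightarrow> sequent list" where
  "best G \<sigma> = (SOME \<pi>. rule_inst G \<pi> \<sigma> \<and>
     (\<forall>\<tau>\<in>set \<pi>. derivable G \<tau> \<and> depth G \<tau> + jump \<tau> \<sigma> \<le> depth G \<sigma>))"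

text \<open>The last inference of a derivation with least bound qualifies: replacing the bound of
  each premise by its depth can only lower it.\<close>

lemma best:
  assumes "derivable G \<sigma>"
  shows "rule_inst G (best G \<sigma>) \<sigma> \<and>
    (\<forall>\<tau>\<in>set (best G \<sigma>). derivable G \<tau> \<and> depth G \<tau> + jump \<tau> \<sigma> \<le> depth G \<sigma>)"
proof -
  have "drv G (depth G \<sigma>) \<sigma>"
    using assms unfolding derivable_def depth_def by (rule LeastI_ex)
  then show ?thesis
  proof cases
    case (drvI \<pi>)
    let ?P = "\<lambda>\<pi>. rule_inst G \<pi> \<sigma> \<and>
      (\<forall>\<tau>\<in>set \<pi>. derivable G \<tau> \<and> depth G \<tau> + jump \<tau> \<sigma> \<le> depth G \<sigma>)"
    have "derivable G \<tau> \<and> depth G \<tau> + jump \<tau> \<sigma> \<le> depth G \<sigma>" if \<tau>: "\<tau> \<in> set \<pi>" for \<tau>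
    proof -
      obtain m where m: "drv G m \<tau>" "m + jump \<tau> \<sigma> \<le> depth G \<sigma>" using drvI(2) \<tau> by blast
      have "depth G \<tau> \<le> m" unfolding depth_def using m(1) by (rule Least_le)
      then show ?thesis using m by (auto simp: derivable_def)
    qed
    then have "?P \<pi>" using drvI(1) by simp
    then have "?P (SOME \<pi>. ?P \<pi>)" by (rule someI)
    then show ?thesis unfolding best_def .
  qed
qed

text \<open>Since every sequent is always derived in the same way, merging the occurrences of a
  sequent into one world of the extracted model cannot increase the height.\<close>

function canon :: "form \<Rightarrow> sequent \<Rightarrow> deriv" where
  "canon G \<sigma> = Der (if derivable G \<sigma> then map (canon G) (best G \<sigma>) else []) \<sigma>"
  by pat_completeness auto
termination
proof (relation "inv_image lex3 (\<lambda>(G, \<sigma>). rank G \<sigma>)")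
  \<comment> \<open>The guard \<open>derivable G \<sigma>\<close> makes
    \<open>best G \<sigma>\<close> a genuine rule instance, so the rank decreases.\<close>
  show "((G, \<tau>), (G, \<sigma>)) \<in> inv_image lex3 (\<lambda>(G, \<sigma>). rank G \<sigma>)"
    if "derivable G \<sigma>" "\<tau> \<in> set (best G \<sigma>)" for G \<sigma> \<tau>
    using rank_premise[of G "best G \<sigma>" \<sigma> \<tau>] best[OF that(1)] that(2) by simp
qed (intro wf_inv_image wf_lex_prod wf_less_than)

declare canon.simps [simp del]

lemma canon_eq:
  "derivable G \<sigma> \<Longrightarrow> canon G \<sigma> = Der (map (canon G) (best G \<sigma>)) \<sigma>"
  by (simp add: canon.simps[of G \<sigma>])

lemma concl_canon [simp]: "concl (canon G \<sigma>) = \<sigma>"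
  by (simp add: canon.simps[of G \<sigma>])

lemma map_concl_canon [simp]: "map concl (map (canon G) \<pi>) = \<pi>"
  by (induction \<pi>) auto

lemma is_deriv_canon: "derivable G \<sigma> \<Longrightarrow> is_deriv G (canon G \<sigma>)"
proof (induction G \<sigma> rule: canon.induct)
  case (1 G \<sigma>)
  have "\<forall>D\<in>set (map (canon G) (best G \<sigma>)). is_deriv G D" using 1 best[OF "1.prems"] by auto
  moreover have "rule_inst G (map concl (map (canon G) (best G \<sigma>))) \<sigma>"
    unfolding map_concl_canon using best[OF "1.prems"] by blast
  ultimately show ?case unfolding canon_eq[OF "1.prems"] by (rule is_deriv.intros)
qed

lemma nodes_canon:
  "derivable G \<sigma> \<Longrightarrow> E \<in> nodes (canon G \<sigma>) \<Longrightarrow> \<exists>\<tau>. derivable G \<tau> \<and> E = canon G \<tau>"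
proof (induction G \<sigma> rule: canon.induct)
  case (1 G \<sigma>)
  show ?case
  proof (cases "E = canon G \<sigma>")
    case True
    then show ?thesis using "1.prems" by blast
  next
    case False
    then obtain \<tau> where \<tau>: "\<tau> \<in> set (best G \<sigma>)" "E \<in> nodes (canon G \<tau>)"
      using "1.prems" by (auto simp: canon_eq)
    have "derivable G \<tau>" using best[OF "1.prems"(1)] \<tau>(1) by blast
    from "1.IH"[OF "1.prems"(1) \<tau>(1) this \<tau>(2)] show ?thesis .
  qed
qed

lemma node_canon:
  assumes "derivable G \<sigma>" "Der Ds \<tau> \<in> nodes (canon G \<sigma>)"
  shows "derivable G \<tau>" "map concl Ds = best G \<tau>"
proof -
  obtain \<tau>' where "derivable G \<tau>'" "Der Ds \<tau> = canon G \<tau>'" using nodes_canon[OF assms] by blast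
  then show "derivable G \<tau>" "map concl Ds = best G \<tau>" by (auto simp: canon_eq o_def)
qed

section \<open>Depth along paths of the canonical derivation\<close>

lemma step_depth:
  assumes "derivable G \<rho>" "step (canon G \<rho>) \<tau> \<sigma>"
  shows "depth G \<tau> + jump \<tau> \<sigma> \<le> depth G \<sigma>"
proof -
  obtain Ds where Ds: "Der Ds \<sigma> \<in> nodes (canon G \<rho>)" "\<tau> \<in> set (map concl Ds)"
    using assms(2) unfolding step_def by blast
  show ?thesis using best[OF node_canon(1)[OF assms(1) Ds(1)]] node_canon(2)[OF assms(1) Ds(1)] Ds(2)
    by simp
qed

text \<open>A path from a regular to an irregular sequent contains a jump somewhere; recording one
  is enough.\<close>

lemma steps_depth:
  assumes "derivable G \<rho>" "(step (canon G \<rho>))\<^sup>*\<^sup>* \<tau> \<sigma>"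
  shows "depth G \<tau> + jump \<tau> \<sigma> \<le> depth G \<sigma>"
  using assms(2)
proof induction
  case (step \<sigma> \<sigma>')
  then show ?case using step_depth[OF assms(1) step.hyps(2)]
    by (auto simp: jump_def split: if_splits)
qed (simp add: jump_def)

lemma p_sequent_depth:
  assumes \<rho>: "derivable G \<rho>" and p: "\<sigma> \<in> p_sequents G (canon G \<rho>)" "\<tau> \<in> p_sequents G (canon G \<rho>)"
    and "(step (canon G \<rho>))\<^sup>*\<^sup>* \<tau> \<sigma>" "\<tau> \<noteq> \<sigma>"
  shows "depth G \<tau> < depth G \<sigma>"
proof -
  obtain \<iota> where
    \<iota>: "(step (canon G \<rho>))\<^sup>*\<^sup>* \<tau> \<iota>" "step (canon G \<rho>) \<iota> \<sigma>"
    using assms(4)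
  proof cases
    case rtrancl_refl
    then show thesis using assms(5) by simp
  next
    case (rtrancl_into_rtrancl \<iota>)
    then show thesis by (rule that)
  qed
  from \<iota>(2) obtain Ds where Ds: "Der Ds \<sigma> \<in> nodes (canon G \<rho>)" "\<iota> \<in> set (map concl Ds)"
    unfolding step_def by blast
  obtain Ds' where Ds': "Der Ds' \<sigma> \<in> nodes (canon G \<rho>)"
    "Ds' = [] \<and> ax_schema G \<sigma> \<or> join_schema G (map concl Ds') \<sigma>"
    using p(1) by (auto simp: p_sequents_def)
  \<comment> \<open>The path may enter another node labelled \<open>\<sigma>\<close> than the one
    witnessing that \<open>\<sigma>\<close> is a world, but both have the premises
    \<open>best G \<sigma>\<close>.\<close>
  have "\<iota> \<in> set (map concl Ds')"
    using node_canon(2)[OF \<rho> Ds(1)] node_canon(2)[OF \<rho> Ds'(1)] Ds(2) by simp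
  then have "\<not> regular \<iota>" using Ds'(2) join_premise_irregular by fastforce
  moreover have "regular \<tau>" using p(2) by (simp add: p_sequents_def)
  ultimately have "jump \<tau> \<iota> = 1" by (simp add: jump_def)
  then show ?thesis using steps_depth[OF \<rho> \<iota>(1)] step_depth[OF \<rho> \<iota>(2)] by simp
qed

lemma model_height_canon:
  assumes "drv G n (Reg \<Gamma> G)"
  shows "\<exists>D. is_deriv_of_goal G D \<and> model_height (Mod G D) \<le> n"
proof (intro exI conjI)
  let ?\<sigma> = "Reg \<Gamma> G" and ?D = "canon G (Reg \<Gamma> G)"
  let ?K = "Mod G ?D"
  have d: "derivable G ?\<sigma>" using assms by (auto simp: derivable_def)
  have D: "is_deriv G ?D" "regular (concl ?D)" using is_deriv_canon[OF d] by simp_all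
  show "is_deriv_of_goal G ?D" using D by (auto simp: is_deriv_of_goal_def)
  have K: "kripke_model ?K" by (rule kripke_model_Mod[OF D])
  have W: "worlds ?K = p_sequents G ?D" "le ?K = p_le ?D" by (simp_all add: Mod_def)
  have root: "root ?K \<in> worlds ?K" using K by (simp add: kripke_model_def)
  then have "height ?K (root ?K) \<le> depth G (root ?K)"
    using K by (intro height_le) (auto simp: above_def W p_le_def intro: p_sequent_depth[OF d])
  also have "\<dots> \<le> depth G ?\<sigma>"
  proof -
    obtain Ds where "Der Ds (root ?K) \<in> nodes ?D" using root by (auto simp: W p_sequents_def)
    from step_concl[OF this] have "(step ?D)\<^sup>*\<^sup>* (root ?K) ?\<sigma>" by simp
    from steps_depth[OF d this] show ?thesis by simp
  qed
  also have "\<dots> \<le> n" unfolding depth_def using assms by (rule Least_le)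
  finally show "model_height ?K \<le> n" by (simp add: model_height_def)
qed

theorem theorem6p3:
  fixes G :: form
  assumes "G \<notin> IPL"
  shows "\<exists>D. is_deriv_of_goal G D \<and> model_height (Mod G D) = min_height G"
proof -
  let ?P = "\<lambda>n. \<exists>K :: nat kripke. countermodel K G \<and> model_height K = n"
  obtain K0 :: "form set kripke" where "countermodel K0 G"
    using finite_countermodel[OF assms] by blast
  from countermodel_nat[OF this] have "\<exists>n. ?P n" by blast
  then have "?P (min_height G)" unfolding min_height_def by (rule LeastI_ex)
  then obtain K :: "nat kripke" where K: "countermodel K G" "model_height K = min_height G"
    by blast
  have "kripke_model K" "root K \<in> worlds K" "\<not> forces K (root K) G"
    using K(1) by (auto simp: countermodel_def kripke_model_def)
  from regular_complete[OF this(1,2) Sr_self this(3)] K(2)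
  obtain \<Gamma> where "drv G (min_height G) (Reg \<Gamma> G)" by (auto simp: model_height_def)
  from model_height_canon[OF this] obtain D
    where D: "is_deriv_of_goal G D" "model_height (Mod G D) \<le> min_height G" by blast
  \<comment> \<open>\<open>min_height\<close> compares models on natural numbers, whereas the worlds
    here are sequents.\<close>
  from countermodel_nat[OF countermodel_Mod[OF D(1)]]
  have "min_height G \<le> model_height (Mod G D)"
    unfolding min_height_def by (rule Least_le)
  with D show ?thesis by (intro exI[of _ D]) simp
qed

end
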